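(* Let $\Omega\subset\mathbb R^d$ be compact, convex, with $0\in\Omega$, let $\nu\in\mathcal P_{2,0}(\Omega)$, and let $\mathcal D\subset\mathcal P_2(\Omega)$ be closed under weak optimizers. Then every maximizer $\mu$ of $\operatorname{Var}$ over $\mathcal D\cap\mathcal M^K_{\nu,\Omega}$ satisfies $\mu\preceq_c\nu$, and consequently $\mu$ maximizes $\operatorname{Var}$ over $\{\mu'\in\mathcal D:\mu'\preceq_c\nu\}$.
   Context: $\mathcal P_2(\Omega)$: Borel probability measures on $\mathbb R^d$ with finite second moment concentrated on $\Omega$; $\mathcal P_{2,0}(\Omega)$: those with zero mean. $\operatorname{Var}(\mu)=\int|x-\int z\,d\mu|^2d\mu$. Convex order: $\mu\preceq_c\nu$ iff $\int fd\mu\le\int fd\nu$ for all convex $f$. Kantorovich dominance: $\mu\preceq_K\nu$ iff there is $\pi\in\Pi(\mu,\nu)$ with $\int\langle x-b_\nu,y-x\rangle\,d\pi=0$, $b_\nu=\int y\,d\nu$; $\mathcal M^K_{\nu,\Omega}=\{\mu\in\mathcal P_2(\Omega):\mu\preceq_K\nu\}$. For $\pi\in\Pi(\mu,\nu)$ disintegrated as $\pi=\mu\otimes\pi_x$, $c_\pi(x)=\int y\,d\pi_x(y)$. $\mathcal D$ is closed under weak optimizers if for every maximizer $\mu$ of $\operatorname{Var}$ over $\mathcal D\cap\mathcal M^K_{\nu,\Omega}$ there is $\pi\in\Pi(\mu,\nu)$ with $\int\langle x,y\rangle\,d\pi(x,y)\ge\int|x|^2d\mu(x)$ and $(c_\pi)_\#\mu\in\mathcal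 D$. *)

theory Defs
  imports "HOL-Probability.Probability"
begin

definition P2 :: "'a::euclidean_space set \<Rightarrow> 'a measure set" where
  "P2 \<Omega> = {M. prob_space M \<and> sets M = sets borel \<and> (AE x in M. x \<in> \<Omega>)
                \<and> integrable M (\<lambda>x. (norm x)\<^sup>2)}"

definition mean :: "'a::euclidean_space measure \<Rightarrow> 'a" where
  "mean M = (\<integral>x. x \<partial>M)"

definition P20 :: "'a::euclidean_space set \<Rightarrow> 'a measure set" where
  "P20 \<Omega> = {M \<in> P2 \<Omega>. mean M = 0}"

definition Var :: "'a::euclidean_space measure \<Rightarrow> real" where
  "Var M = (\<integral>x. (norm (x - mean M))\<^sup>2 \<partial>M)"

definition convex_order :: "'a::euclidean_space measure \<Rightarrow> 'a measure \<Rightarrow> bool" where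
  "convex_order \<mu> \<nu> = (\<forall>f::'a \<Rightarrow> real. convex_on UNIV f \<longrightarrow> (\<integral>x. f x \<partial>\<mu>) \<le> (\<integral>x. f x \<partial>\<nu>))"

definition couplings :: "'a::euclidean_space measure \<Rightarrow> 'a measure \<Rightarrow> ('a \<times> 'a) measure set" where
  "couplings \<mu> \<nu> = {\<pi>. prob_space \<pi> \<and> sets \<pi> = sets borel
       \<and> distr \<pi> borel fst = \<mu> \<and> distr \<pi> borel snd = \<nu>}"

definition K_dom :: "'a::euclidean_space measure \<Rightarrow> 'a measure \<Rightarrow> bool" where
  "K_dom \<mu> \<nu> = (\<exists>\<pi>\<in>couplings \<mu> \<nu>. (\<integral>p. inner (fst p - mean \<nu>) (snd p - fst p) \<partial>\<pi>) = 0)"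

definition MK :: "'a::euclidean_space measure \<Rightarrow> 'a set \<Rightarrow> 'a measure set" where
  "MK \<nu> \<Omega> = {\<mu> \<in> P2 \<Omega>. K_dom \<mu> \<nu>}"

text \<open>c is (a version of) the barycenter map x \<mapsto> \<integral> y d\<pi>_x(y) of the disintegration
  \<pi> = \<mu> \<otimes> \<pi>_x, characterised by \<integral>_A c d\<mu> = \<integral>_{A \<times> R^d} y d\<pi> for all Borel A.\<close>
definition barycenter_map :: "('a::euclidean_space \<times> 'a) measure \<Rightarrow> 'a measure \<Rightarrow> ('a \<Rightarrow> 'a) \<Rightarrow> bool" where
  "barycenter_map \<pi> \<mu> c = (c \<in> borel_measurable borel \<and> integrable \<mu> c \<and>
     (\<forall>A\<in>sets borel. (\<integral>x. indicator A x *\<^sub>R c x \<partial>\<mu>) = (\<integral>p. indicator A (fst p) *\<^sub>R snd p \<partial>\<pi>)))"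

definition maximizes_Var :: "'a::euclidean_space measure set \<Rightarrow> 'a measure \<Rightarrow> bool" where
  "maximizes_Var S \<mu> = (\<mu> \<in> S \<and> (\<forall>\<mu>'\<in>S. Var \<mu>' \<le> Var \<mu>))"

definition closed_weak_opt :: "'a::euclidean_space measure set \<Rightarrow> 'a measure \<Rightarrow> 'a set \<Rightarrow> bool" where
  "closed_weak_opt D \<nu> \<Omega> = (\<forall>\<mu>. maximizes_Var (D \<inter> MK \<nu> \<Omega>) \<mu> \<longrightarrow>
     (\<exists>\<pi>\<in>couplings \<mu> \<nu>. (\<integral>p. inner (fst p) (snd p) \<partial>\<pi>) \<ge> (\<integral>x. (norm x)\<^sup>2 \<partial>\<mu>)
        \<and> (\<exists>c. barycenter_map \<pi> \<mu> c \<and> distr \<mu> borel c \<in> D)))"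

end

theory Submission
  imports Defs
begin

text \<open>
  Let \<open>\<pi>\<close> be the coupling provided by closedness under weak optimizers and \<open>c\<close> its barycenter map.
  The image \<open>\<eta>\<close> of \<open>\<mu>\<close> under \<open>c\<close> is again Kantorovich dominated by \<open>\<nu>\<close>, via the image of \<open>\<pi>\<close> under
  \<open>(x, y) \<mapsto> (c x, y)\<close>, and has mean zero. Hence
  \<open>\<integral>|c|\<^sup>2 d\<mu> = Var \<eta> \<le> Var \<mu> \<le> \<integral>|x|\<^sup>2 d\<mu> \<le> \<integral>\<langle>x, y\<rangle> d\<pi> = \<integral>\<langle>x, c\<rangle> d\<mu>\<close>,
  so \<open>\<integral>|x - c|\<^sup>2 d\<mu> \<le> 0\<close>; thus \<open>\<pi>\<close> is a martingale coupling and Jensen's inequality gives the convex order.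

  For the second claim, convex order must imply Kantorovich dominance on compact sets.
  A Blackwell-type greedy choice of points shows that a moment problem on \<open>[0,1]\<close> is solvable
  approximately by empirical measures, hence exactly by Helly's theorem, as soon as no finite linear
  combination of the moment constraints separates. Transported to \<open>\<Omega> \<times> \<Omega>\<close> by a space-filling curve,
  this yields a coupling with \<open>\<integral>\<langle>x, y\<rangle> d\<pi> = \<integral>|x|\<^sup>2 d\<mu>\<close>: a separating combination
  \<open>A x + B y + s \<langle>x, y\<rangle>\<close> is refuted by testing the convex order against the convex function
  \<open>y \<mapsto> sup\<^sub>x (- A x - s \<langle>x, y\<rangle>)\<close>.
\<close>

section \<open>Integrability on compact sets\<close>

lemma borel_measurable_continuous_UNIV:
  "continuous_on UNIV f \<Longrightarrow> sets M = sets borel \<Longrightarrow> f \<in> borel_measurable M"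
  by (metis borel_measurable_continuous_onI measurable_cong_sets)

lemma integrable_continuous_AE_compact:
  fixes f :: "'a::euclidean_space \<Rightarrow> 'b::euclidean_space"
  assumes "prob_space M" "sets M = sets borel" "compact K" "AE x in M. x \<in> K" "continuous_on UNIV f"
  shows "integrable M f"
proof -
  interpret prob_space M by fact
  have "compact (f ` K)"
    using assms by (intro compact_continuous_image) (auto intro: continuous_on_subset)
  then obtain B where "\<And>x. x \<in> K \<Longrightarrow> norm (f x) \<le> B"
    by (metis bounded_iff compact_imp_bounded imageI)
  then show ?thesis
    using assms by (intro integrable_const_bound[where B=B])
      (auto intro: borel_measurable_continuous_UNIV elim: eventually_mono)
qed

lemma P2D:
  assumes "M \<in> P2 \<Omega>"
  shows "prob_space M" "sets M = sets borel" "AE x in M. x \<in> \<Omega>" "integrable M (\<lambda>x. (norm x)\<^sup>2)"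
  using assms by (auto simp: P2_def)

section \<open>Solvability of moment problems on the unit interval\<close>

lemma exists_bounded_partial_sums:
  fixes w :: "nat \<Rightarrow> 'b \<Rightarrow> real"
  assumes half: "\<And>a. \<exists>t\<in>T. (\<Sum>j<n. a j * w j t) \<le> 0"
    and bound: "\<And>j t. j < n \<Longrightarrow> \<bar>w j t\<bar> \<le> C"
  obtains s :: "nat \<Rightarrow> 'b"
    where "range s \<subseteq> T" "\<And>k. (\<Sum>j<n. (\<Sum>i<k. w j (s i))\<^sup>2) \<le> real k * (real n * C\<^sup>2)"
proof -
  \<comment> \<open>Choosing each new point in the half-space opposite to the current sum \<open>V\<close> makes the cross term
    in the square of the norm nonpositive, so the norm of \<open>V k\<close> grows only like \<open>sqrt k\<close>.\<close>
  define pick where "pick a = (SOME t. t \<in> T \<and> (\<Sum>j<n. a j * w j t) \<le> 0)" for a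
  have pick: "pick a \<in> T" "(\<Sum>j<n. a j * w j (pick a)) \<le> 0" for a
    using someI_ex[of "\<lambda>t. t \<in> T \<and> (\<Sum>j<n. a j * w j t) \<le> 0"] half[of a]
    unfolding pick_def by blast+
  define V where "V = rec_nat (\<lambda>j. 0) (\<lambda>_ v j. v j + w j (pick v))"
  have V0: "V 0 j = 0" and VSuc: "V (Suc k) j = V k j + w j (pick (V k))" for j k
    by (simp_all add: V_def)
  define s where "s k = pick (V k)" for k
  have V_sum: "V k j = (\<Sum>i<k. w j (s i))" for k j
    by (induction k) (auto simp: V0 VSuc s_def)
  have "(\<Sum>j<n. (V k j)\<^sup>2) \<le> real k * (real n * C\<^sup>2)" for k
  proof (induction k)
    case 0
    then show ?case by (simp add: V0)
  next
    case (Suc k)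
    have sq: "(w j t)\<^sup>2 \<le> C\<^sup>2" if "j < n" for j t
      using bound[OF that, of t] by (metis abs_le_square_iff abs_of_nonneg abs_ge_zero order_trans)
    have "(\<Sum>j<n. (V (Suc k) j)\<^sup>2)
        = (\<Sum>j<n. (V k j)\<^sup>2) + 2 * (\<Sum>j<n. V k j * w j (pick (V k))) + (\<Sum>j<n. (w j (pick (V k)))\<^sup>2)"
      by (simp add: VSuc power2_sum sum.distrib sum_distrib_left algebra_simps)
    also have "(\<Sum>j<n. (w j (pick (V k)))\<^sup>2) \<le> (\<Sum>j<n. C\<^sup>2)"
      by (intro sum_mono sq) auto
    finally show ?case
      using Suc pick(2)[of "V k"] by (simp add: algebra_simps)
  qed
  then show ?thesis
    using that[of s] pick(1) by (auto simp: V_sum s_def)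
qed

text \<open>The measure is the empirical distribution of the first \<open>k\<close> greedily chosen
  points: its moment errors are the partial sums divided by \<open>k\<close>, hence of order
  \<open>1 / sqrt k\<close>.\<close>

lemma exists_measure_approx_moments:
  fixes u :: "nat \<Rightarrow> real \<Rightarrow> real" and m :: "nat \<Rightarrow> real"
  assumes meas[measurable]: "\<And>j. u j \<in> borel_measurable borel"
    and bound: "\<And>j t. \<bar>u j t\<bar> \<le> C j"
    and half: "\<And>a. \<exists>t\<in>T. (\<Sum>j<n. a j * (u j t - m j)) \<le> 0"
    and "e > 0"
  obtains M where "real_distribution M" "AE t in M. t \<in> T" "\<And>j. j < n \<Longrightarrow> \<bar>(\<integral>t. u j t \<partial>M) - m j\<bar> \<le> e"
proof -
  define B where "B = (\<Sum>j<n. C j + \<bar>m j\<bar>)"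
  have Cnn: "0 \<le> C j" for j using bound[of j 0] by linarith
  have B: "\<bar>u j t - m j\<bar> \<le> B" if "j < n" for j t
  proof -
    have "\<bar>u j t - m j\<bar> \<le> C j + \<bar>m j\<bar>" using bound[of j t] by linarith
    also have "\<dots> \<le> B" unfolding B_def
      by (rule member_le_sum) (use that Cnn in auto)
    finally show ?thesis .
  qed
  obtain s where s: "range s \<subseteq> T"
    "\<And>k. (\<Sum>j<n. (\<Sum>i<k. u j (s i) - m j)\<^sup>2) \<le> real k * (real n * B\<^sup>2)"
    using exists_bounded_partial_sums[where T=T and n=n and C=B and w="\<lambda>j t. u j t - m j", OF half B] by blast
  \<comment> \<open>This size makes the bound \<open>real k * (real n * B\<^sup>2)\<close> on the
    squared sums at most \<open>(real k * e)\<^sup>2\<close>.\<close>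
  obtain k :: nat where k: "real k > real n * B\<^sup>2 / e\<^sup>2" using reals_Archimedean2 by blast
  have "0 \<le> real n * B\<^sup>2 / e\<^sup>2" by simp
  then have "real k > 0" using k by linarith
  then have k0: "k > 0" by simp
  define p where "p = pmf_of_set {..<k}"
  define M where "M = distr (measure_pmf p) borel s"
  have ne: "{..<k} \<noteq> {}" using k0 by auto
  have "real_distribution M"
    unfolding M_def by (rule prob_space.real_distribution_distr[OF measure_pmf.prob_space_axioms]) simp
  moreover have "AE t in M. t \<in> T"
  proof -
    \<comment> \<open>\<open>T\<close> is arbitrary and may fail to be Borel, so the claim passes
      through the countable set \<open>range s\<close>.\<close>
    have "AE i in measure_pmf p. s i \<in> range s" by simp
    moreover have "range s \<in> sets borel" by (rule sets.countable) auto
    ultimately have "AE t in M. t \<in> range s"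
      unfolding M_def by (subst AE_distr_iff) simp_all
    then show ?thesis by eventually_elim (use s(1) in auto)
  qed
  moreover have "\<bar>(\<integral>t. u j t \<partial>M) - m j\<bar> \<le> e" if "j < n" for j
  proof -
    have eq: "(\<integral>t. u j t \<partial>M) - m j = (\<Sum>i<k. u j (s i) - m j) / k"
      unfolding M_def p_def using k0 ne
      by (subst integral_distr) (auto simp: integral_pmf_of_set sum_subtractf field_simps)
    have "(\<Sum>i<k. u j (s i) - m j)\<^sup>2 \<le> (\<Sum>j<n. (\<Sum>i<k. u j (s i) - m j)\<^sup>2)"
      by (rule member_le_sum) (use that in auto)
    also have "\<dots> \<le> real k * (real n * B\<^sup>2)" by (rule s(2))
    also have "\<dots> \<le> real k * (real k * e\<^sup>2)"
      using k \<open>e > 0\<close> by (intro mult_left_mono) (auto simp: field_simps)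
    finally have "(\<Sum>i<k. u j (s i) - m j)\<^sup>2 \<le> (real k * e)\<^sup>2"
      by (simp add: power2_eq_square algebra_simps)
    then have "\<bar>\<Sum>i<k. u j (s i) - m j\<bar> \<le> real k * e"
      using \<open>e > 0\<close> unfolding abs_le_square_iff[symmetric] by (simp add: abs_mult)
    then show ?thesis unfolding eq using k0 by (simp add: field_simps)
  qed
  ultimately show ?thesis using that by blast
qed

text \<open>Approximate solutions carried by \<open>[0,1]\<close> form a tight sequence, so Helly's
  selection theorem yields a weakly convergent subsequence, and the bounded continuous
  \<open>u j\<close> pass to the limit. The measure \<open>N n\<close> takes care of the first
  \<open>n\<close> constraints only, with error \<open>1 / (n + 1)\<close>.\<close>

lemma exists_measure_moments:
  fixes u :: "nat \<Rightarrow> real \<Rightarrow> real" and m :: "nat \<Rightarrow> real"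
  assumes cont: "\<And>j t. isCont (u j) t"
    and bound: "\<And>j t. \<bar>u j t\<bar> \<le> C j"
    and half: "\<And>n a. \<exists>t\<in>{0..1}. (\<Sum>j<n. a j * (u j t - m j)) \<le> 0"
  obtains M where "real_distribution M" "\<And>j. (\<integral>t. u j t \<partial>M) = m j"
proof -
  have meas[measurable]: "u j \<in> borel_measurable borel" for j
    using cont by (auto intro!: borel_measurable_continuous_onI continuous_at_imp_continuous_on)
  have "\<exists>M. real_distribution M \<and> (AE t in M. t \<in> {0..1}) \<and>
      (\<forall>j<n. \<bar>(\<integral>t. u j t \<partial>M) - m j\<bar> \<le> 1 / real (Suc n))" for n
    by (rule exists_measure_approx_moments[where u=u and C=C and T="{0..1}" and n=n and m=m and e="1 / real (Suc n)"])
       (use bound half in auto)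
  then obtain N where N: "\<And>n. real_distribution (N n)" "\<And>n. AE t in N n. t \<in> {0..1}"
    "\<And>n j. j < n \<Longrightarrow> \<bar>(\<integral>t. u j t \<partial>N n) - m j\<bar> \<le> 1 / real (Suc n)"
    by metis
  have "tight N"
    unfolding tight_def
  proof (intro conjI allI impI N(1))
    fix e :: real assume "e > 0"
    \<comment> \<open>Tightness is phrased with half-open intervals, so the left end must lie
      strictly below 0.\<close>
    have "measure (N n) {-1<..1} = 1" for n
    proof -
      interpret real_distribution "N n" by (rule N(1))
      show ?thesis
        using N(2)[of n] by (subst prob_eq_1) (auto elim: eventually_mono)
    qed
    then show "\<exists>a b. a < b \<and> (\<forall>n. 1 - e < measure (N n) {a<..b})"
      using \<open>e > 0\<close> by (intro exI[of _ "-1"] exI[of _ 1]) auto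
  qed
  then obtain r M where r: "strict_mono (r :: nat \<Rightarrow> nat)" and M: "real_distribution M"
    and conv: "weak_conv_m (N \<circ> id \<circ> r) M"
    using tight_imp_convergent_subsubsequence[of N id] by (auto simp: strict_mono_def)
  have "(\<integral>t. u j t \<partial>M) = m j" for j
  proof (rule LIMSEQ_unique)
    show "(\<lambda>n. \<integral>t. u j t \<partial>(N \<circ> id \<circ> r) n) \<longlonglongrightarrow> (\<integral>t. u j t \<partial>M)"
      using weak_conv_imp_integral_bdd_continuous_conv[of "N \<circ> id \<circ> r" M "u j" "C j"] N(1) M conv cont bound
      by simp
    have lim: "(\<lambda>n. 1 / real (Suc n)) \<longlonglongrightarrow> 0"
      using LIMSEQ_inverse_real_of_nat by (simp add: divide_inverse)
    \<comment> \<open>Constraint \<open>j\<close> is controlled only from \<open>n > j\<close> on,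
      so the comparison is an eventual one.\<close>
    have "(\<lambda>n. (\<integral>t. u j t \<partial>N n) - m j) \<longlonglongrightarrow> 0"
    proof (rule Lim_null_comparison[OF _ lim])
      show "\<forall>\<^sub>F n in sequentially. norm ((\<integral>t. u j t \<partial>N n) - m j) \<le> 1 / real (Suc n)"
        using eventually_gt_at_top[of j] by eventually_elim (use N(3) in auto)
    qed
    then have "(\<lambda>n. (\<integral>t. u j t \<partial>N n)) \<longlonglongrightarrow> m j"
      by (simp add: LIM_zero_iff)
    then show "(\<lambda>n. \<integral>t. u j t \<partial>(N \<circ> id \<circ> r) n) \<longlonglongrightarrow> m j"
      using LIMSEQ_subseq_LIMSEQ[OF _ r] by (auto simp: comp_def)
  qed
  then show ?thesis using that M by blast
qed

section \<open>Space-filling curves\<close>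

text \<open>Schoenberg's curve: \<open>tooth\<close> has period 2, vanishes on \<open>[0,1/3]\<close> and equals 1 on \<open>[2/3,1]\<close>, so
  \<open>tooth (3 ^ j * t)\<close> reads off the \<open>j\<close>-th ternary digit of a point \<open>t\<close> of the Cantor set.\<close>
definition tooth :: "real \<Rightarrow> real" where
  "tooth t = max 0 (min 1 (1/2 - cos (pi * t)))"

lemma isCont_tooth [continuous_intros]: "isCont tooth t"
  unfolding tooth_def by (intro continuous_intros)

lemma tooth_range: "0 \<le> tooth t" "tooth t \<le> 1"
  by (auto simp: tooth_def)

lemma tooth_periodic: "tooth (2 * real n + t) = tooth t"
proof -
  have "cos (pi * (2 * real n + t)) = cos (pi * t + 2 * pi * of_int (int n))"
    by (simp add: algebra_simps)
  also have "\<dots> = cos (pi * t)"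
    using cos_int_2pin[of "int n"] sin_int_2pin[of "int n"] by (simp add: cos_add)
  finally show ?thesis by (simp add: tooth_def)
qed

lemma tooth_eq_0:
  assumes "0 \<le> t" "t \<le> 1/3" shows "tooth t = 0"
proof -
  have "cos (pi / 3) \<le> cos (pi * t)"
    using assms by (intro cos_monotone_0_pi_le) (auto simp: field_simps)
  then show ?thesis by (simp add: tooth_def cos_60)
qed

lemma tooth_eq_1:
  assumes "2/3 \<le> t" "t \<le> 1" shows "tooth t = 1"
proof -
  have "cos (pi * t) \<le> cos (pi - pi / 3)"
    using assms by (intro cos_monotone_0_pi_le) (auto simp: field_simps)
  then show ?thesis by (simp add: tooth_def cos_120)
qed

text \<open>The parametrization of the Cantor set by 0-1 sequences. Only the ternary digits 0 and 2
  occur, which keeps the fractional parts met below out of the gap between 1/3 and 2/3, where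
  \<open>tooth\<close> rises from 0 to 1.\<close>

definition ternary :: "(nat \<Rightarrow> bool) \<Rightarrow> real" where
  "ternary d = (\<Sum>j. 2 * of_bool (d j) * (1/3) ^ Suc j)"

lemma summable_ternary: "summable (\<lambda>j. 2 * of_bool (d j) * (1/3) ^ Suc j :: real)"
proof (rule summable_comparison_test'[where N=0])
  show "summable (\<lambda>j. 2 * (1/3) ^ j :: real)"
    by (intro summable_mult summable_geometric) simp
qed (simp add: abs_mult)

lemma ternary_range: "0 \<le> ternary d" "ternary d \<le> 1"
proof -
  show "0 \<le> ternary d"
    unfolding ternary_def by (intro suminf_nonneg summable_ternary) auto
  have "(\<lambda>j. (2/3) * (1/3)^j :: real) sums ((2/3) * (1 / (1 - 1/3)))"
    by (intro sums_mult geometric_sums) auto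
  then have s: "(\<lambda>j. (2/3) * (1/3)^j :: real) sums 1" by simp
  have "ternary d \<le> (\<Sum>j. (2/3) * (1/3)^j)"
    unfolding ternary_def using s
    by (intro suminf_le summable_ternary) (auto intro: sums_summable)
  then show "ternary d \<le> 1" using s by (simp add: sums_iff)
qed

lemma ternary_step: "3 * ternary d = 2 * of_bool (d 0) + ternary (\<lambda>j. d (Suc j))"
proof -
  have "ternary d = (\<Sum>j. 2 * of_bool (d (Suc j)) * (1/3) ^ Suc (Suc j)) + 2 * of_bool (d 0) * (1/3)"
    unfolding ternary_def using suminf_split_head[OF summable_ternary[of d]] by simp
  also have "(\<Sum>j. 2 * of_bool (d (Suc j)) * (1/3) ^ Suc (Suc j)) = (1/3) * ternary (\<lambda>j. d (Suc j))"
    unfolding ternary_def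
    by (subst suminf_mult[symmetric, OF summable_ternary]) (simp add: algebra_simps)
  finally show ?thesis by simp
qed

text \<open>Multiplication by 3 shifts the digits and turns the leading one into 0 or 2. After
  further factors of 3 this is still an even integer, which the period absorbs. At
  \<open>j = 0\<close> the leading digit decides between \<open>[0,1/3]\<close> and
  \<open>[2/3,1]\<close>.\<close>

lemma tooth_ternary: "tooth (3 ^ j * ternary d) = of_bool (d j)"
proof (induction j arbitrary: d)
  case 0
  show ?case
    using ternary_step[of d] ternary_range[of "\<lambda>j. d (Suc j)"]
    by (cases "d 0") (auto intro!: tooth_eq_0 tooth_eq_1)
next
  case (Suc j)
  have "3 ^ Suc j * ternary d = 3 ^ j * (3 * ternary d)" by simp
  also have "\<dots> = 2 * real (3 ^ j * of_bool (d 0)) + 3 ^ j * ternary (\<lambda>j. d (Suc j))"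
    unfolding ternary_step by (simp add: algebra_simps)
  finally show ?case by (simp only: tooth_periodic Suc)
qed

text \<open>Greedy expansion: \<open>r k\<close> is the remainder after \<open>k\<close> digits,
  scaled by \<open>2 ^ k\<close>. It stays in \<open>[0,1]\<close> with the right endpoint included,
  so \<open>a = 1\<close> receives only digits 1.\<close>

lemma exists_binary_digits:
  fixes a :: real
  assumes "0 \<le> a" "a \<le> 1"
  obtains d :: "nat \<Rightarrow> bool" where "(\<lambda>k. (1/2) ^ Suc k * of_bool (d k)) sums a"
proof -
  define r where "r = rec_nat a (\<lambda>_ x. 2 * x - of_bool (x \<ge> 1/2))"
  have r0: "r 0 = a" and rSuc: "r (Suc k) = 2 * r k - of_bool (r k \<ge> 1/2)" for k
    by (simp_all add: r_def)
  have range: "0 \<le> r k \<and> r k \<le> 1" for k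
    by (induction k) (use assms in \<open>auto simp: r0 rSuc\<close>)
  have part: "a - (\<Sum>k<n. (1/2) ^ Suc k * of_bool (r k \<ge> 1/2)) = (1/2) ^ n * r n" for n
    by (induction n) (auto simp: r0 rSuc algebra_simps)
  have "(\<lambda>n. a - (\<Sum>k<n. (1/2) ^ Suc k * of_bool (r k \<ge> 1/2))) \<longlonglongrightarrow> 0"
  proof (rule Lim_null_comparison)
    show "\<forall>\<^sub>F n in sequentially. norm (a - (\<Sum>k<n. (1/2) ^ Suc k * of_bool (r k \<ge> 1/2))) \<le> (1/2) ^ n"
      unfolding part using range by (auto simp: mult_left_le)
    show "(\<lambda>n. (1/2) ^ n :: real) \<longlonglongrightarrow> 0" by (rule LIMSEQ_realpow_zero) auto
  qed
  then have "(\<lambda>n. a - (a - (\<Sum>k<n. (1/2) ^ Suc k * of_bool (r k \<ge> 1/2)))) \<longlonglongrightarrow> a - 0"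
    by (intro tendsto_diff tendsto_const)
  then have "(\<lambda>k. (1/2) ^ Suc k * of_bool (r k \<ge> 1/2)) sums a"
    by (simp add: sums_def)
  then show ?thesis by (rule that)
qed

text \<open>For \<open>i < m\<close>, coordinate \<open>i\<close> of Schoenberg's curve into the
  \<open>m\<close>-dimensional unit cube: the ternary digits at positions congruent to
  \<open>i\<close> modulo \<open>m\<close> serve as binary digits of that coordinate.\<close>

definition schoenberg :: "nat \<Rightarrow> nat \<Rightarrow> real \<Rightarrow> real" where
  "schoenberg m i t = (\<Sum>k. (1/2) ^ Suc k * tooth (3 ^ (m * k + i) * t))"

section \<open>Range, continuity and surjectivity of Schoenberg's curve\<close>

lemma half_powers_sums: "(\<lambda>k. (1/2) ^ Suc k :: real) sums 1"
  using power_half_series by simp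

lemma schoenberg_term_le: "norm ((1/2) ^ Suc k * tooth x) \<le> (1/2) ^ Suc k"
  using tooth_range[of x] by (simp add: abs_mult mult_left_le)

lemma summable_schoenberg: "summable (\<lambda>k. (1/2) ^ Suc k * tooth (3 ^ (m * k + i) * t))"
  using sums_summable[OF half_powers_sums] schoenberg_term_le
  by (rule summable_comparison_test')

lemma schoenberg_range: "0 \<le> schoenberg m i t" "schoenberg m i t \<le> 1"
proof -
  show "0 \<le> schoenberg m i t"
    unfolding schoenberg_def by (intro suminf_nonneg summable_schoenberg) (auto simp: tooth_range)
  have "schoenberg m i t \<le> (\<Sum>k. (1/2) ^ Suc k)"
    unfolding schoenberg_def
    by (intro suminf_le summable_schoenberg sums_summable[OF half_powers_sums] mult_left_le tooth_range) simp
  then show "schoenberg m i t \<le> 1" using half_powers_sums by (simp add: sums_iff)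
qed

lemma isCont_schoenberg: "isCont (schoenberg m i) t"
proof -
  have "uniform_limit UNIV (\<lambda>n t. \<Sum>k<n. (1/2) ^ Suc k * tooth (3 ^ (m * k + i) * t))
     (\<lambda>t. \<Sum>k. (1/2) ^ Suc k * tooth (3 ^ (m * k + i) * t)) sequentially"
    by (rule Weierstrass_m_test[where M="\<lambda>k. (1/2) ^ Suc k"])
       (rule schoenberg_term_le sums_summable[OF half_powers_sums])+
  moreover have "isCont (\<lambda>t. tooth (3 ^ k * t)) t" for k t
    by (rule isCont_o2[OF _ isCont_tooth]) (intro continuous_intros)
  then have "continuous_on UNIV (\<lambda>t. \<Sum>k<n. (1/2) ^ Suc k * tooth (3 ^ (m * k + i) * t))" for n
    by (intro continuous_intros continuous_at_imp_continuous_on) auto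
  ultimately have "continuous_on UNIV (schoenberg m i)"
    unfolding schoenberg_def[abs_def]
    by (intro uniform_limit_theorem always_eventually) auto
  then show ?thesis by (simp add: continuous_on_eq_continuous_at)
qed

text \<open>The binary expansions of the \<open>m\<close> coordinates are interleaved into one point
  of the Cantor set: \<open>j mod m\<close> selects the coordinate and \<open>j div m\<close> the
  binary place.\<close>

lemma schoenberg_surj:
  assumes a: "\<And>i. i < m \<Longrightarrow> 0 \<le> a i \<and> a i \<le> 1"
  obtains t where "t \<in> {0..1}" "\<And>i. i < m \<Longrightarrow> schoenberg m i t = a i"
proof -
  have "\<exists>d. i < m \<longrightarrow> (\<lambda>k. (1/2) ^ Suc k * of_bool (d k)) sums a i" for i
    using a exists_binary_digits by metis
  then obtain d where d: "\<And>i. i < m \<Longrightarrow> (\<lambda>k. (1/2) ^ Suc k * of_bool (d i k)) sums a i"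
    by metis
  define t where "t = ternary (\<lambda>j. d (j mod m) (j div m))"
  have "schoenberg m i t = a i" if "i < m" for i
    using d[OF that] that by (simp add: schoenberg_def t_def tooth_ternary sums_iff)
  then show ?thesis using that[of t] ternary_range by (auto simp: t_def)
qed

text \<open>Lets a measure be sought as the image of a measure on the line, where Helly's theorem
  applies. The curve fills a cube of half-side \<open>R\<close> around the origin, the affine image
  of the unit cube, so it may leave \<open>K\<close>.\<close>

lemma exists_space_filling_curve:
  fixes K :: "'b::euclidean_space set"
  assumes "bounded K"
  obtains h :: "real \<Rightarrow> 'b" where "\<And>t. isCont h t" "bounded (range h)" "K \<subseteq> h ` {0..1}"
proof -
  obtain R where R: "R > 0" "\<And>x. x \<in> K \<Longrightarrow> norm x \<le> R"
    using assms by (auto simp: bounded_pos)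
  define m where "m = card (Basis :: 'b set)"
  obtain e where e: "bij_betw e (Basis :: 'b set) {0..<m}"
    using ex_bij_betw_finite_nat[OF finite_Basis] unfolding m_def by blast
  define h :: "real \<Rightarrow> 'b" where
    "h t = (\<Sum>b\<in>Basis. (R * (2 * schoenberg m (e b) t - 1)) *\<^sub>R b)" for t
  have inner_h: "h t \<bullet> b = R * (2 * schoenberg m (e b) t - 1)" if "b \<in> Basis" for t b
    using that by (simp add: h_def)
  have "isCont h t" for t
    unfolding h_def by (intro continuous_intros isCont_schoenberg)
  moreover have "bounded (range h)"
  proof (rule boundedI, clarify)
    fix t
    have "norm (h t) \<le> (\<Sum>b\<in>Basis. \<bar>h t \<bullet> b\<bar>)" by (rule norm_le_l1)
    also have "\<dots> \<le> (\<Sum>b\<in>(Basis::'b set). R)"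
    proof (rule sum_mono)
      fix b :: 'b assume "b \<in> Basis"
      moreover have "\<bar>2 * schoenberg m (e b) t - 1\<bar> \<le> 1"
        using schoenberg_range[of m "e b" t] by (simp add: abs_le_iff)
      ultimately show "\<bar>h t \<bullet> b\<bar> \<le> R"
        using R(1) by (simp add: inner_h abs_mult mult_left_le)
    qed
    finally show "norm (h t) \<le> (\<Sum>b\<in>(Basis::'b set). R)" .
  qed
  moreover have "K \<subseteq> h ` {0..1}"
  proof
    fix x assume "x \<in> K"
    \<comment> \<open>The coordinates of \<open>x\<close>, rescaled from \<open>[-R,R]\<close> to
      \<open>[0,1]\<close> and numbered through \<open>e\<close>.\<close>
    define a where "a i = (x \<bullet> inv_into Basis e i / R + 1) / 2" for i
    have "0 \<le> a i \<and> a i \<le> 1" if "i < m" for i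
    proof -
      have "inv_into Basis e i \<in> Basis"
        using e that by (auto simp: bij_betw_def intro!: inv_into_into)
      then have "\<bar>x \<bullet> inv_into Basis e i\<bar> \<le> R"
        using R(2)[OF \<open>x \<in> K\<close>] Basis_le_norm[of "inv_into Basis e i" x] by linarith
      then show ?thesis using R(1) by (auto simp: a_def field_simps abs_le_iff)
    qed
    then obtain t where t: "t \<in> {0..1}" "\<And>i. i < m \<Longrightarrow> schoenberg m i t = a i"
      using schoenberg_surj[of m a] by blast
    have "h t = x"
    proof (rule euclidean_eqI)
      fix b :: 'b assume "b \<in> Basis"
      moreover from this have "e b < m" "inv_into Basis e (e b) = b"
        using e by (auto simp: bij_betw_def)
      ultimately show "h t \<bullet> b = x \<bullet> b"
        using R(1) by (simp add: inner_h t(2) a_def field_simps)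
    qed
    then show "x \<in> h ` {0..1}" using t(1) by blast
  qed
  ultimately show ?thesis using that by blast
qed

section \<open>Couplings from the convex order\<close>

text \<open>Turns a marginal condition into countably many moment constraints. The indicator of an
  open set is the pointwise limit of truncated multiples of the distance to its complement, and the
  measure is determined on a countable base closed under finite intersections.\<close>

lemma exists_measure_determining_sequence:
  obtains p :: "nat \<Rightarrow> 'a::euclidean_space \<Rightarrow> real"
  where "\<And>k. continuous_on UNIV (p k)" "\<And>k x. 0 \<le> p k x \<and> p k x \<le> 1"
    "\<And>M N. prob_space M \<Longrightarrow> prob_space N \<Longrightarrow> sets M = sets borel \<Longrightarrow> sets N = sets borel \<Longrightarrow>
       (\<And>k. (\<integral>x. p k x \<partial>M) = (\<integral>x. p k x \<partial>N)) \<Longrightarrow> M = N"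
proof -
  obtain B :: "'a set set" where B: "countable B" "topological_basis B"
    using ex_countable_basis by blast
  \<comment> \<open>The empty subfamily contributes \<open>UNIV\<close>, since
    \<open>\<Inter>{} = UNIV\<close>.\<close>
  define E where "E = Inter ` {F. finite F \<and> F \<subseteq> B}"
  have "countable E"
    unfolding E_def using countable_Collect_finite_subset[OF B(1)] by (rule countable_image)
  have "UNIV \<in> E" unfolding E_def by (intro image_eqI[where x="{}"]) auto
  have E_open: "open U" if "U \<in> E" for U
    using that B(2) by (auto simp: E_def intro!: open_Inter dest: topological_basis_open)
  have stable: "Int_stable E"
  proof (rule Int_stableI)
    fix U V assume "U \<in> E" "V \<in> E"
    then obtain F G where "finite F" "F \<subseteq> B" "U = \<Inter>F" "finite G" "G \<subseteq> B" "V = \<Inter>G"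
      by (auto simp: E_def)
    then show "U \<inter> V \<in> E"
      unfolding E_def by (intro image_eqI[where x="F \<union> G"]) auto
  qed
  have borel_E: "sets borel = sigma_sets UNIV E"
  proof -
    have "sigma_sets UNIV B = sigma_sets UNIV E"
    proof (rule sigma_sets_eqI)
      fix b assume "b \<in> B"
      then have "b \<in> E" unfolding E_def by (intro image_eqI[where x="{b}"]) auto
      then show "b \<in> sigma_sets UNIV E" by blast
    next
      fix e assume "e \<in> E"
      then have "e \<in> sets borel" by (simp add: E_open)
      then show "e \<in> sigma_sets UNIV B" by (simp add: borel_eq_countable_basis[OF B])
    qed
    then show ?thesis by (simp add: borel_eq_countable_basis[OF B])
  qed
  \<comment> \<open>The whole space is treated apart because \<open>infdist\<close> to the empty set
    is 0 by convention.\<close>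
  define g where "g U n x = (if U = UNIV then 1 else min 1 (real n * infdist x (- U)))"
    for U :: "'a set" and n :: nat and x
  have g_cont: "continuous_on UNIV (g U n)" for U n
    unfolding g_def by (cases "U = UNIV") (auto intro!: continuous_intros)
  have g_range: "0 \<le> g U n x \<and> g U n x \<le> 1" for U n x
    by (auto simp: g_def infdist_nonneg)
  have g_lim: "(\<lambda>n. g U n x) \<longlonglongrightarrow> indicator U x" if "open U" for U x
  proof (cases "U = UNIV \<or> x \<notin> U")
    case True
    then show ?thesis by (cases "U = UNIV") (auto simp: g_def)
  next
    case False
    then have pos: "infdist x (- U) > 0"
      using \<open>open U\<close> by (intro infdist_pos_not_in_closed) auto
    obtain n0 :: nat where n0: "1 / infdist x (- U) < n0" using reals_Archimedean2 by blast
    have "g U n x = 1" if "n \<ge> n0" for n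
    proof -
      have "1 < real n0 * infdist x (- U)" using n0 pos by (simp add: field_simps)
      also have "\<dots> \<le> real n * infdist x (- U)" using that pos by (intro mult_right_mono) auto
      finally show ?thesis by (simp add: g_def)
    qed
    then have "\<forall>\<^sub>F n in sequentially. g U n x = indicator U x"
      using False by (auto simp: eventually_sequentially)
    then show ?thesis by (rule tendsto_eventually)
  qed
  have lim: "(\<lambda>n. \<integral>x. g U n x \<partial>M) \<longlonglongrightarrow> measure M U"
    if "prob_space M" "sets M = sets borel" "U \<in> E" for M U
  proof -
    interpret prob_space M by fact
    have [measurable]: "U \<in> sets M" using E_open[OF that(3)] that(2) by simp
    have [measurable]: "g U n \<in> borel_measurable M" for n
      using g_cont that(2) by (rule borel_measurable_continuous_UNIV)
    have "(\<lambda>n. \<integral>x. g U n x \<partial>M) \<longlonglongrightarrow> (\<integral>x. indicator U x \<partial>M)"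
      by (rule integral_dominated_convergence[where w="\<lambda>_. 1"])
        (use g_lim[OF E_open[OF that(3)]] g_range in auto)
    then show ?thesis using sets.sets_into_space[OF \<open>U \<in> sets M\<close>] by (simp add: Int_absorb2)
  qed
  define T where "T = (\<lambda>(U, n). g U n) ` (E \<times> UNIV)"
  have "countable T" unfolding T_def using \<open>countable E\<close> by blast
  have "T \<noteq> {}" unfolding T_def using \<open>UNIV \<in> E\<close> by blast
  define p where "p = from_nat_into T"
  have p_range: "range p = T"
    unfolding p_def using \<open>T \<noteq> {}\<close> \<open>countable T\<close> by (rule range_from_nat_into)
  have p_ex: "\<exists>U n. p k = g U n" for k
  proof -
    have "p k \<in> T" using p_range by blast
    then show ?thesis by (auto simp: T_def)
  qed
  show ?thesis
  proof (rule that)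
    show "continuous_on UNIV (p k)" for k using p_ex[of k] g_cont by auto
    show "0 \<le> p k x \<and> p k x \<le> 1" for k x using p_ex[of k] g_range by auto
    fix M N :: "'a measure"
    assume M: "prob_space M" "sets M = sets borel" and N: "prob_space N" "sets N = sets borel"
      and eq: "\<And>k. (\<integral>x. p k x \<partial>M) = (\<integral>x. p k x \<partial>N)"
    interpret M: prob_space M by fact
    interpret N: prob_space N by fact
    have eq_g: "(\<integral>x. g U n x \<partial>M) = (\<integral>x. g U n x \<partial>N)" if "U \<in> E" for U n
    proof -
      have "g U n \<in> range p" unfolding p_range T_def using that by force
      then show ?thesis using eq by auto
    qed
    show "M = N"
    proof (rule measure_eqI_generator_eq[OF stable, where \<Omega>=UNIV and A="\<lambda>_. UNIV"])
      fix U assume "U \<in> E"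
      have "measure M U = measure N U"
        using lim[OF M \<open>U \<in> E\<close>] lim[OF N \<open>U \<in> E\<close>] eq_g[OF \<open>U \<in> E\<close>] LIMSEQ_unique by auto
      then show "emeasure M U = emeasure N U"
        by (simp add: M.emeasure_eq_measure N.emeasure_eq_measure)
    qed (use M N borel_E \<open>UNIV \<in> E\<close> in \<open>auto simp: M.emeasure_eq_measure\<close>)
  qed
qed

text \<open>Duality step. If the reverse strict inequality held on all of
  \<open>\<Omega> \<times> \<Omega>\<close>, the function \<open>\<psi>\<close> would lie strictly
  below \<open>B - c\<close> on \<open>\<Omega>\<close>, and at least as high as
  \<open>- A x - s * (norm x)\<^sup>2\<close> there. Integrating against \<nu> and \<mu> then
  contradicts the convex order.\<close>

lemma convex_order_not_separated:
  fixes A B :: "'a::euclidean_space \<Rightarrow> real"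
  assumes "compact \<Omega>" "\<Omega> \<noteq> {}" and \<mu>: "\<mu> \<in> P2 \<Omega>" and \<nu>: "\<nu> \<in> P2 \<Omega>" and co: "convex_order \<mu> \<nu>"
    and A: "continuous_on UNIV A" and B: "continuous_on UNIV B"
  shows "\<exists>x\<in>\<Omega>. \<exists>y\<in>\<Omega>. A x + B y + s * (x \<bullet> y)
    \<le> (\<integral>x. A x \<partial>\<mu>) + (\<integral>y. B y \<partial>\<nu>) + s * (\<integral>x. (norm x)\<^sup>2 \<partial>\<mu>)"
proof (rule ccontr)
  define c where "c = (\<integral>x. A x \<partial>\<mu>) + (\<integral>y. B y \<partial>\<nu>) + s * (\<integral>x. (norm x)\<^sup>2 \<partial>\<mu>)"
  assume "\<not> ?thesis"
  then have gt: "c < A x + B y + s * (x \<bullet> y)" if "x \<in> \<Omega>" "y \<in> \<Omega>" for x y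
    using that by (force simp: c_def)
  \<comment> \<open>The supremum over the compact \<open>\<Omega>\<close> is attained. Hence \<psi>
    is finite everywhere, and its value comes from a point of \<open>\<Omega>\<close>, where the
    strict inequality \<open>gt\<close> is available.\<close>
  have "\<exists>x\<in>\<Omega>. \<forall>z\<in>\<Omega>. - A z - s * (z \<bullet> y) \<le> - A x - s * (x \<bullet> y)" for y
    using assms(1,2) by (intro continuous_attains_sup continuous_intros continuous_on_subset[OF A]) auto
  then obtain X where X: "\<And>y. X y \<in> \<Omega>"
    "\<And>y z. z \<in> \<Omega> \<Longrightarrow> - A z - s * (z \<bullet> y) \<le> - A (X y) - s * (X y \<bullet> y)"
    by metis
  define \<psi> where "\<psi> y = - A (X y) - s * (X y \<bullet> y)" for y
  have "convex_on UNIV \<psi>"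
  proof (rule convex_onI)
    fix t :: real and x y :: 'a assume t: "0 < t" "t < 1"
    \<comment> \<open>The maximizer at the convex combination is a competitor at both
      \<open>x\<close> and \<open>y\<close>: a supremum of affine functions is convex.\<close>
    define z where "z = X ((1 - t) *\<^sub>R x + t *\<^sub>R y)"
    have "\<psi> ((1 - t) *\<^sub>R x + t *\<^sub>R y) = (1 - t) * (- A z - s * (z \<bullet> x)) + t * (- A z - s * (z \<bullet> y))"
      unfolding \<psi>_def z_def by (simp add: inner_add_right algebra_simps)
    also have "\<dots> \<le> (1 - t) * \<psi> x + t * \<psi> y"
      unfolding \<psi>_def using t X by (intro add_mono mult_left_mono) (auto simp: z_def)
    finally show "\<psi> ((1 - t) *\<^sub>R x + t *\<^sub>R y) \<le> (1 - t) * \<psi> x + t * \<psi> y" .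
  qed simp
  then have \<psi>_cont: "continuous_on UNIV \<psi>" by (intro convex_on_continuous) auto
  have int_\<mu>: "integrable \<mu> f" if "continuous_on UNIV f" for f :: "'a \<Rightarrow> real"
    using integrable_continuous_AE_compact P2D[OF \<mu>] assms(1) that by blast
  have int_\<nu>: "integrable \<nu> f" if "continuous_on UNIV f" for f :: "'a \<Rightarrow> real"
    using integrable_continuous_AE_compact P2D[OF \<nu>] assms(1) that by blast
  interpret \<mu>: prob_space \<mu> using P2D[OF \<mu>] by simp
  interpret \<nu>: prob_space \<nu> using P2D[OF \<nu>] by simp
  have "- (\<integral>x. A x \<partial>\<mu>) - s * (\<integral>x. (norm x)\<^sup>2 \<partial>\<mu>) = (\<integral>x. - A x - s * (norm x)\<^sup>2 \<partial>\<mu>)"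
    using int_\<mu>[OF A] P2D(4)[OF \<mu>] by simp
  also have "\<dots> \<le> (\<integral>x. \<psi> x \<partial>\<mu>)"
  proof (rule integral_mono_AE)
    \<comment> \<open>Here the competitor in the supremum is the point \<open>x\<close>
      itself.\<close>
    show "AE x in \<mu>. - A x - s * (norm x)\<^sup>2 \<le> \<psi> x"
      using P2D(3)[OF \<mu>] X(2) by (auto simp: \<psi>_def power2_norm_eq_inner elim!: eventually_mono)
  qed (use int_\<mu>[OF A] P2D(4)[OF \<mu>] int_\<mu>[OF \<psi>_cont] in auto)
  also have "\<dots> \<le> (\<integral>x. \<psi> x \<partial>\<nu>)"
    using co \<open>convex_on UNIV \<psi>\<close> by (simp add: convex_order_def)
  also have "\<dots> < (\<integral>x. B x - c \<partial>\<nu>)"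
  proof (rule \<nu>.integral_less_AE_space)
    show "AE x in \<nu>. \<psi> x < B x - c"
      using P2D(3)[OF \<nu>]
    proof eventually_elim
      fix y assume "y \<in> \<Omega>"
      then show "\<psi> y < B y - c" using gt[OF X(1)[of y]] by (simp add: \<psi>_def algebra_simps)
    qed
  qed (use int_\<nu>[OF B] int_\<nu>[OF \<psi>_cont] \<nu>.emeasure_space_1 in auto)
  also have "\<dots> = (\<integral>x. B x \<partial>\<nu>) - c"
    using int_\<nu>[OF B] \<nu>.prob_space by simp
  finally show False by (simp add: c_def)
qed

text \<open>Less than Strassen's theorem is required: instead of a martingale coupling, only its
  consequence for the cost is prescribed, as one moment constraint in addition to the
  marginals.\<close>

lemma convex_order_imp_coupling:
  fixes \<mu> \<nu> :: "'a::euclidean_space measure"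
  assumes "compact \<Omega>" and \<mu>: "\<mu> \<in> P2 \<Omega>" and \<nu>: "\<nu> \<in> P2 \<Omega>" and co: "convex_order \<mu> \<nu>"
  obtains \<pi> where "\<pi> \<in> couplings \<mu> \<nu>" "(\<integral>q. fst q \<bullet> snd q \<partial>\<pi>) = (\<integral>x. (norm x)\<^sup>2 \<partial>\<mu>)"
proof -
  interpret \<mu>: prob_space \<mu> using P2D[OF \<mu>] by simp
  interpret \<nu>: prob_space \<nu> using P2D[OF \<nu>] by simp
  have ne: "\<Omega> \<noteq> {}"
    using P2D(3)[OF \<mu>] \<mu>.AE_False by auto
  obtain p :: "nat \<Rightarrow> 'a \<Rightarrow> real" where p: "\<And>k. continuous_on UNIV (p k)" "\<And>k x. 0 \<le> p k x \<and> p k x \<le> 1"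
    "\<And>M N. prob_space M \<Longrightarrow> prob_space N \<Longrightarrow> sets M = sets borel \<Longrightarrow> sets N = sets borel \<Longrightarrow>
       (\<And>k. (\<integral>x. p k x \<partial>M) = (\<integral>x. p k x \<partial>N)) \<Longrightarrow> M = N"
    using exists_measure_determining_sequence by metis
  obtain h :: "real \<Rightarrow> 'a \<times> 'a" where h: "\<And>t. isCont h t" "bounded (range h)" "\<Omega> \<times> \<Omega> \<subseteq> h ` {0..1}"
    using exists_space_filling_curve[of "\<Omega> \<times> \<Omega>"] assms(1) compact_imp_bounded bounded_Times by metis
  obtain R where R: "\<And>t. norm (h t) \<le> R" using h(2) by (auto simp: bounded_iff)
  \<comment> \<open>Interleave three kinds of constraints: the cost (once is enough), the first and the second marginal.\<close>
  define P where "P j = (if j mod 3 = 1 then p (j div 3) else (\<lambda>_. 0))" for j :: nat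
  define Q where "Q j = (if j mod 3 = 2 then p (j div 3) else (\<lambda>_. 0))" for j :: nat
  define s :: "nat \<Rightarrow> real" where "s j = (if j mod 3 = 0 then 1 else 0)" for j
  have P_cont: "continuous_on UNIV (P j)" and Q_cont: "continuous_on UNIV (Q j)" for j
    using p(1) by (auto simp: P_def Q_def)
  \<comment> \<open>The constraints pulled back along the curve \<open>h\<close>; \<open>m j\<close>
    is the value that a coupling with the desired cost would give.\<close>
  define u where "u j t = P j (fst (h t)) + Q j (snd (h t)) + s j * (fst (h t) \<bullet> snd (h t))" for j t
  define m where "m j = (\<integral>x. P j x \<partial>\<mu>) + (\<integral>y. Q j y \<partial>\<nu>) + s j * (\<integral>x. (norm x)\<^sup>2 \<partial>\<mu>)" for j
  have u_cont: "isCont (u j) t" for j t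
  proof -
    have c: "isCont (P j) x" "isCont (Q j) x" for x
      using P_cont Q_cont by (auto simp: continuous_on_eq_continuous_at)
    show ?thesis
      unfolding u_def by (intro continuous_intros isCont_o2[OF _ c(1)] isCont_o2[OF _ c(2)] h(1))
  qed
  have u_bound: "\<bar>u j t\<bar> \<le> 2 + R * R" for j t
  proof -
    have "\<bar>fst (h t) \<bullet> snd (h t)\<bar> \<le> norm (fst (h t)) * norm (snd (h t))"
      by (rule Cauchy_Schwarz_ineq2)
    also have "\<dots> \<le> R * R"
      using R[of t] norm_fst_le[of "fst (h t)" "snd (h t)"] norm_snd_le[of "snd (h t)" "fst (h t)"]
      by (intro mult_mono) (auto intro: order_trans[OF norm_ge_zero])
    finally have i: "\<bar>fst (h t) \<bullet> snd (h t)\<bar> \<le> R * R" .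
    moreover from this have "0 \<le> R * R" by simp
    moreover have "\<bar>P j (fst (h t))\<bar> \<le> 1" "\<bar>Q j (snd (h t))\<bar> \<le> 1"
      using p(2) by (auto simp: P_def Q_def abs_of_nonneg)
    ultimately show ?thesis by (auto simp: u_def s_def)
  qed
  have int_P: "integrable \<mu> (P j)" for j
    using integrable_continuous_AE_compact P2D[OF \<mu>] assms(1) P_cont by blast
  have int_Q: "integrable \<nu> (Q j)" for j
    using integrable_continuous_AE_compact P2D[OF \<nu>] assms(1) Q_cont by blast
  have half: "\<exists>t\<in>{0..1}. (\<Sum>j<n. a j * (u j t - m j)) \<le> 0" for n and a :: "nat \<Rightarrow> real"
  proof -
    \<comment> \<open>A finite combination of constraints has again the form
      \<open>A x + B y + s * (x \<bullet> y)\<close>, so the duality step yields a pair in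
      \<open>\<Omega> \<times> \<Omega>\<close>, which the curve attains.\<close>
    have "continuous_on UNIV (\<lambda>x. \<Sum>j<n. a j * P j x)" "continuous_on UNIV (\<lambda>x. \<Sum>j<n. a j * Q j x)"
      by (auto intro!: continuous_intros P_cont Q_cont)
    from convex_order_not_separated[OF assms(1) ne \<mu> \<nu> co this, of "\<Sum>j<n. a j * s j"]
    obtain x y where xy: "x \<in> \<Omega>" "y \<in> \<Omega>"
      "(\<Sum>j<n. a j * P j x) + (\<Sum>j<n. a j * Q j y) + (\<Sum>j<n. a j * s j) * (x \<bullet> y)
        \<le> (\<integral>x. (\<Sum>j<n. a j * P j x) \<partial>\<mu>) + (\<integral>x. (\<Sum>j<n. a j * Q j x) \<partial>\<nu>)
          + (\<Sum>j<n. a j * s j) * (\<integral>x. (norm x)\<^sup>2 \<partial>\<mu>)"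
      by blast
    obtain t where t: "t \<in> {0..1}" "h t = (x, y)" using xy(1,2) h(3) by (metis SigmaI imageE subsetD)
    have "(\<Sum>j<n. a j * u j t) = (\<Sum>j<n. a j * P j x) + (\<Sum>j<n. a j * Q j y) + (\<Sum>j<n. a j * s j) * (x \<bullet> y)"
      by (simp add: u_def t(2) sum.distrib sum_distrib_right distrib_left mult.assoc)
    moreover have "(\<Sum>j<n. a j * m j) = (\<integral>x. (\<Sum>j<n. a j * P j x) \<partial>\<mu>) + (\<integral>x. (\<Sum>j<n. a j * Q j x) \<partial>\<nu>)
          + (\<Sum>j<n. a j * s j) * (\<integral>x. (norm x)\<^sup>2 \<partial>\<mu>)"
      using int_P int_Q by (simp add: m_def sum.distrib sum_distrib_right distrib_left mult.assoc)
    ultimately show ?thesis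
      using xy(3) t(1) by (intro bexI[of _ t]) (auto simp: sum_subtractf algebra_simps)
  qed
  obtain M where M: "real_distribution M" "\<And>j. (\<integral>t. u j t \<partial>M) = m j"
    using exists_measure_moments[where u=u and C="\<lambda>_. 2 + R * R" and m=m, OF u_cont u_bound half] by blast
  interpret M: real_distribution M by fact
  have h_meas[measurable]: "h \<in> borel_measurable M"
    using h(1) by (intro borel_measurable_continuous_UNIV continuous_at_imp_continuous_on) auto
  have fst_meas[measurable]: "(fst :: 'a \<times> 'a \<Rightarrow> 'a) \<in> borel_measurable borel"
    and snd_meas[measurable]: "(snd :: 'a \<times> 'a \<Rightarrow> 'a) \<in> borel_measurable borel"
    by (auto intro!: borel_measurable_continuous_onI continuous_intros)
  have p_meas[measurable]: "p k \<in> borel_measurable borel" for k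
    using p(1) by (rule borel_measurable_continuous_onI)
  \<comment> \<open>Decodes the interleaving: index \<open>3 * k + 1\<close> tests the first
    marginal with \<open>p k\<close>, and index \<open>3 * k + 2\<close> the second.\<close>
  have div3: "Suc (3 * k) div 3 = k" "Suc (Suc (3 * k)) div 3 = k"
    "Suc (3 * k) mod 3 = 1" "Suc (Suc (3 * k)) mod 3 = 2" for k by presburger+
  define \<pi> where "\<pi> = distr M borel h"
  interpret \<pi>: prob_space \<pi>
    unfolding \<pi>_def by (rule M.prob_space_distr) measurable
  have sets_\<pi>[measurable_cong]: "sets \<pi> = sets borel" by (simp add: \<pi>_def)
  have "distr \<pi> borel fst = \<mu>"
  proof (rule p(3))
    fix k
    have "(\<integral>x. p k x \<partial>distr \<pi> borel fst) = (\<integral>t. p k (fst (h t)) \<partial>M)"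
      by (simp add: \<pi>_def integral_distr)
    also have "\<dots> = (\<integral>x. p k x \<partial>\<mu>)"
      using M(2)[of "3 * k + 1"] by (simp add: div3 u_def m_def P_def Q_def s_def)
    finally show "(\<integral>x. p k x \<partial>distr \<pi> borel fst) = (\<integral>x. p k x \<partial>\<mu>)" .
  qed (use P2D[OF \<mu>] in \<open>auto intro!: \<pi>.prob_space_distr\<close>)
  moreover have "distr \<pi> borel snd = \<nu>"
  proof (rule p(3))
    fix k
    have "(\<integral>x. p k x \<partial>distr \<pi> borel snd) = (\<integral>t. p k (snd (h t)) \<partial>M)"
      by (simp add: \<pi>_def integral_distr)
    also have "\<dots> = (\<integral>x. p k x \<partial>\<nu>)"
      using M(2)[of "3 * k + 2"] by (simp add: div3 u_def m_def P_def Q_def s_def)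
    finally show "(\<integral>x. p k x \<partial>distr \<pi> borel snd) = (\<integral>x. p k x \<partial>\<nu>)" .
  qed (use P2D[OF \<nu>] in \<open>auto intro!: \<pi>.prob_space_distr\<close>)
  ultimately have "\<pi> \<in> couplings \<mu> \<nu>"
    by (simp add: couplings_def \<pi>.prob_space_axioms sets_\<pi>)
  moreover have "(\<integral>q. fst q \<bullet> snd q \<partial>\<pi>) = (\<integral>x. (norm x)\<^sup>2 \<partial>\<mu>)"
    using M(2)[of 0] by (simp add: \<pi>_def integral_distr u_def m_def P_def Q_def s_def)
  ultimately show ?thesis using that by blast
qed

section \<open>Convex order from martingale couplings\<close>

text \<open>A hyperplane separates \<open>(x, f x)\<close> from the strict epigraph; it is not
  vertical because \<open>f\<close> is finite on the whole space, so its slope is a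
  subgradient.\<close>

lemma convex_on_imp_subgradient:
  fixes f :: "'a::euclidean_space \<Rightarrow> real"
  assumes "convex_on UNIV f"
  obtains g where "\<And>y. f x + g \<bullet> (y - x) \<le> f y"
proof -
  define S where "S = {q :: 'a \<times> real. f (fst q) < snd q}"
  have "convex S"
    unfolding convex_def
  proof (intro ballI allI impI)
    fix p q :: "'a \<times> real" and u v :: real
    assume pq: "p \<in> S" "q \<in> S" and uv: "0 \<le> u" "0 \<le> v" "u + v = 1"
    have "f (u *\<^sub>R fst p + v *\<^sub>R fst q) \<le> u * f (fst p) + v * f (fst q)"
      using assms uv by (simp add: convex_on_def)
    also have "\<dots> < u * snd p + v * snd q"
    proof (cases "u = 0")
      case True
      then show ?thesis using pq uv by (simp add: S_def)
    next
      case False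
      then show ?thesis using pq uv
        by (intro add_less_le_mono mult_strict_left_mono mult_left_mono) (auto simp: S_def)
    qed
    finally show "u *\<^sub>R p + v *\<^sub>R q \<in> S" by (simp add: S_def)
  qed
  moreover have "(x, f x + 1) \<in> S" "{(x, f x)} \<inter> S = {}" by (auto simp: S_def)
  ultimately obtain a b where ab: "a \<noteq> 0" "a \<bullet> (x, f x) \<le> b" "\<And>q. q \<in> S \<Longrightarrow> b \<le> a \<bullet> q"
    using separating_hyperplane_sets[of "{(x, f x)}" S] by fastforce
  obtain w s where a: "a = (w, s)" by (cases a)
  have sep: "w \<bullet> x + s * f x \<le> w \<bullet> y + s * r" if "f y < r" for y r
    using ab(2) ab(3)[of "(y, r)"] that by (simp add: a S_def)
  have "s \<ge> 0" using sep[of x "f x + 1"] by (simp add: algebra_simps)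
  \<comment> \<open>A vertical hyperplane is refuted by moving from \<open>x\<close> in the
    direction \<open>- w\<close>.\<close>
  moreover have "s \<noteq> 0"
  proof
    assume "s = 0"
    then have "0 \<le> w \<bullet> - w" using sep[of "x - w" "f (x - w) + 1"] by (simp add: inner_diff_right)
    then have "w = 0" 
      by (metis inner_eq_zero_iff inner_ge_zero inner_minus_right neg_0_le_iff_le order_antisym)
    with \<open>s = 0\<close> a have "a = 0" by (simp add: zero_prod_def)
    with ab(1) show False ..
  qed
  ultimately have "s > 0" by simp
  \<comment> \<open>\<open>sep\<close> speaks only of points strictly above the graph, hence the
    limit over \<open>e\<close>.\<close>
  have "f x + (- w /\<^sub>R s) \<bullet> (y - x) \<le> f y" for y
  proof (rule field_le_epsilon)
    fix e :: real assume "e > 0"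
    then show "f x + (- w /\<^sub>R s) \<bullet> (y - x) \<le> f y + e"
      using sep[of y "f y + e"] \<open>s > 0\<close> by (simp add: field_simps inner_diff_right)
  qed
  then show ?thesis by (rule that)
qed

text \<open>The open sets on which a given tangent stays within \<open>e\<close> of \<open>f\<close>
  cover \<open>K\<close>, so finitely many tangents suffice.\<close>

lemma convex_on_finite_affine_approx:
  fixes f :: "'a::euclidean_space \<Rightarrow> real"
  assumes f: "convex_on UNIV f" and "compact K" "e > 0"
  obtains n :: nat and g :: "nat \<Rightarrow> 'a" and b :: "nat \<Rightarrow> real"
  where "\<And>i y. g i \<bullet> y + b i \<le> f y" "\<And>x. x \<in> K \<Longrightarrow> \<exists>i<n. f x \<le> g i \<bullet> x + b i + e"
proof -
  have cont: "continuous_on UNIV f" using f by (intro convex_on_continuous) auto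
  have "\<exists>g. \<forall>y. f x + g \<bullet> (y - x) \<le> f y" for x
    using convex_on_imp_subgradient[OF f, of x] by metis
  then obtain G where G: "\<And>x y. f x + G x \<bullet> (y - x) \<le> f y" by metis
  define U where "U x = {y. f y < f x + G x \<bullet> (y - x) + e}" for x
  have "open (U x)" for x
    unfolding U_def by (intro open_Collect_less continuous_intros cont)
  moreover have "K \<subseteq> (\<Union>x\<in>K. U x)" using \<open>e > 0\<close> by (auto simp: U_def)
  ultimately obtain C where C: "finite C" "K \<subseteq> (\<Union>x\<in>C. U x)"
    using compactE_image[OF \<open>compact K\<close>, of K U] by metis
  obtain xs where xs: "set xs = C" using finite_list[OF C(1)] by blast
  show ?thesis
  proof (rule that[of "\<lambda>i. G (xs ! i)" "\<lambda>i. f (xs ! i) - G (xs ! i) \<bullet> (xs ! i)" "length xs"])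
    \<comment> \<open>This holds for every \<open>i\<close>, also beyond the end of the list:
      whatever point \<open>xs ! i\<close> denotes there, \<open>G\<close> gives a subgradient at
      it.\<close>
    show "G (xs ! i) \<bullet> y + (f (xs ! i) - G (xs ! i) \<bullet> (xs ! i)) \<le> f y" for i y
      using G[of "xs ! i" y] by (simp add: inner_diff_right)
    fix x assume "x \<in> K"
    then obtain i where "i < length xs" "x \<in> U (xs ! i)"
      using C(2) xs by (metis UN_E in_set_conv_nth subsetD)
    then show "\<exists>i<length xs. f x \<le> G (xs ! i) \<bullet> x + (f (xs ! i) - G (xs ! i) \<bullet> (xs ! i)) + e"
      by (intro exI[of _ i]) (auto simp: U_def inner_diff_right)
  qed
qed

section \<open>Transfer of measurability, null sets and integrals between a coupling and its
  marginals\<close>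

lemma couplings_measurable:
  fixes \<pi> :: "('a::euclidean_space \<times> 'a) measure"
  assumes "\<pi> \<in> couplings \<mu> \<nu>"
  shows "fst \<in> borel_measurable \<pi>" "snd \<in> borel_measurable \<pi>"
  using assms by (auto simp: couplings_def intro!: borel_measurable_continuous_UNIV continuous_intros)

lemma couplings_AE:
  assumes "\<pi> \<in> couplings \<mu> \<nu>"
  shows "AE x in \<mu>. P x \<Longrightarrow> AE q in \<pi>. P (fst q)" "AE x in \<nu>. P x \<Longrightarrow> AE q in \<pi>. P (snd q)"
  using AE_distrD[OF couplings_measurable(1)[OF assms], of P]
    AE_distrD[OF couplings_measurable(2)[OF assms], of P] assms
  by (auto simp: couplings_def)

lemma couplings_integral:
  fixes f :: "'a::euclidean_space \<Rightarrow> 'b::{banach, second_countable_topology}"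
  assumes "\<pi> \<in> couplings \<mu> \<nu>" "f \<in> borel_measurable borel"
  shows "(\<integral>q. f (fst q) \<partial>\<pi>) = (\<integral>x. f x \<partial>\<mu>)" "(\<integral>q. f (snd q) \<partial>\<pi>) = (\<integral>x. f x \<partial>\<nu>)"
    "integrable \<pi> (\<lambda>q. f (fst q)) \<longleftrightarrow> integrable \<mu> f" "integrable \<pi> (\<lambda>q. f (snd q)) \<longleftrightarrow> integrable \<nu> f"
proof -
  have d: "\<mu> = distr \<pi> borel fst" "\<nu> = distr \<pi> borel snd" using assms(1) by (auto simp: couplings_def)
  note m = couplings_measurable[OF assms(1)]
  show "(\<integral>q. f (fst q) \<partial>\<pi>) = (\<integral>x. f x \<partial>\<mu>)" "integrable \<pi> (\<lambda>q. f (fst q)) \<longleftrightarrow> integrable \<mu> f"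
    unfolding d(1) using m(1) assms(2) by (simp_all add: integral_distr integrable_distr_eq)
  show "(\<integral>q. f (snd q) \<partial>\<pi>) = (\<integral>x. f x \<partial>\<nu>)" "integrable \<pi> (\<lambda>q. f (snd q)) \<longleftrightarrow> integrable \<nu> f"
    unfolding d(2) using m(2) assms(2) by (simp_all add: integral_distr integrable_distr_eq)
qed

lemma sum_indicator_disjointed:
  "(\<Sum>i<n. indicator (disjointed A i) x) = (indicator (\<Union>i<n. A i) x :: real)"
  by (induction n) (auto simp: disjointed_def lessThan_Suc atLeast0LessThan indicator_def)

text \<open>Conditional Jensen inequality without conditional measures. Up to a null set the first
  coordinate is split into finitely many Borel pieces, on each of which one affine minorant is
  within \<open>e\<close> of \<open>f\<close>. Affine functions have equal integrals in
  \<open>x\<close> and in \<open>y\<close> over each piece.\<close>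

lemma martingale_coupling_imp_convex_order:
  fixes \<mu> \<nu> :: "'a::euclidean_space measure"
  assumes "compact \<Omega>" and \<mu>: "\<mu> \<in> P2 \<Omega>" and \<nu>: "\<nu> \<in> P2 \<Omega>" and \<pi>: "\<pi> \<in> couplings \<mu> \<nu>"
    and bary: "barycenter_map \<pi> \<mu> (\<lambda>x. x)"
  shows "convex_order \<mu> \<nu>"
  unfolding convex_order_def
proof (intro allI impI)
  fix f :: "'a \<Rightarrow> real" assume f: "convex_on UNIV f"
  then have f_cont: "continuous_on UNIV f" by (intro convex_on_continuous) auto
  have [measurable]: "f \<in> borel_measurable borel" using f_cont by (rule borel_measurable_continuous_onI)
  interpret \<mu>: prob_space \<mu> using P2D[OF \<mu>] by simp
  interpret \<nu>: prob_space \<nu> using P2D[OF \<nu>] by simp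
  interpret \<pi>: prob_space \<pi> using \<pi> by (simp add: couplings_def)
  have [measurable_cong]: "sets \<mu> = sets borel" using P2D[OF \<mu>] by simp
  note [measurable] = couplings_measurable[OF \<pi>]
  have int_\<mu>: "integrable \<mu> h" if "continuous_on UNIV h" for h :: "'a \<Rightarrow> 'b::euclidean_space"
    using integrable_continuous_AE_compact P2D[OF \<mu>] assms(1) that by blast
  have int_\<nu>: "integrable \<nu> h" if "continuous_on UNIV h" for h :: "'a \<Rightarrow> 'b::euclidean_space"
    using integrable_continuous_AE_compact P2D[OF \<nu>] assms(1) that by blast
  have int_snd: "integrable \<pi> (\<lambda>q. h (snd q))" if "continuous_on UNIV h" for h :: "'a \<Rightarrow> 'b::euclidean_space"
    using couplings_integral(4)[OF \<pi> borel_measurable_continuous_onI[OF that]] int_\<nu>[OF that] by simp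
  have ind_fst: "integrable \<pi> (\<lambda>q. indicator D (fst q) *\<^sub>R h (snd q))"
    if "D \<in> sets borel" "continuous_on UNIV h" for D and h :: "'a \<Rightarrow> 'b::euclidean_space"
  proof -
    have "integrable \<pi> (\<lambda>q. indicator (fst -` D \<inter> space \<pi>) q *\<^sub>R h (snd q))"
      using that int_snd measurable_sets[OF couplings_measurable(1)[OF \<pi>]]
      by (intro integrable_mult_indicator) auto
    then show ?thesis
      by (rule Bochner_Integration.integrable_cong[THEN iffD1, rotated 2]) (auto simp: indicator_def)
  qed
  show "(\<integral>x. f x \<partial>\<mu>) \<le> (\<integral>x. f x \<partial>\<nu>)"
  proof (rule field_le_epsilon)
    fix e :: real assume "e > 0"
    obtain n :: nat and g :: "nat \<Rightarrow> 'a" and b :: "nat \<Rightarrow> real"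
      where below: "\<And>i y. g i \<bullet> y + b i \<le> f y"
        and near: "\<And>x. x \<in> \<Omega> \<Longrightarrow> \<exists>i<n. f x \<le> g i \<bullet> x + b i + e"
      using convex_on_finite_affine_approx[OF f assms(1) \<open>e > 0\<close>] by metis
    \<comment> \<open>Each point is assigned to the first tangent that is good enough there, which
      makes the cover a partition.\<close>
    define D where "D = disjointed (\<lambda>i. {x. f x \<le> g i \<bullet> x + b i + e})"
    have [measurable]: "{x. f x \<le> g i \<bullet> x + b i + e} \<in> sets borel" for i
      by measurable
    have D[measurable]: "D i \<in> sets borel" for i
      unfolding D_def by (rule range_subsetD[OF sets.range_disjointed_sets]) auto
    have D_sub: "f x \<le> g i \<bullet> x + b i + e" if "x \<in> D i" for i x
      using that disjointed_subset[of "\<lambda>i. {x. f x \<le> g i \<bullet> x + b i + e}" i] by (auto simp: D_def)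
    have D_sum: "(\<Sum>i<n. indicator (D i) x) = (1::real)" if "x \<in> \<Omega>" for x
      unfolding D_def sum_indicator_disjointed using near[OF that] by (auto simp: indicator_def)
    \<comment> \<open>The linear part is the barycenter identity on \<open>D i\<close>, the constant
      part the first marginal.\<close>
    have affine: "(\<integral>x. indicator (D i) x * (g i \<bullet> x + b i) \<partial>\<mu>)
        = (\<integral>q. indicator (D i) (fst q) * (g i \<bullet> snd q + b i) \<partial>\<pi>)" for i
    proof -
      have int1: "integrable \<mu> (\<lambda>x. indicator (D i) x *\<^sub>R x)"
        by (intro integrable_mult_indicator int_\<mu> continuous_intros) auto
      have int2: "integrable \<pi> (\<lambda>q. indicator (D i) (fst q) *\<^sub>R snd q)"
        by (rule ind_fst[of _ "\<lambda>x. x"]) auto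
      have int3: "integrable \<mu> (\<lambda>x. indicator (D i) x *\<^sub>R b i)"
        by (intro integrable_mult_indicator int_\<mu> continuous_intros) auto
      have int4: "integrable \<pi> (\<lambda>q. indicator (D i) (fst q) *\<^sub>R b i)"
        by (rule ind_fst[of _ "\<lambda>_. b i"]) auto
      have "(\<integral>x. indicator (D i) x * (g i \<bullet> x + b i) \<partial>\<mu>)
          = (\<integral>x. g i \<bullet> (indicator (D i) x *\<^sub>R x) + indicator (D i) x *\<^sub>R b i \<partial>\<mu>)"
        by (simp add: algebra_simps)
      also have "\<dots> = g i \<bullet> (\<integral>x. indicator (D i) x *\<^sub>R x \<partial>\<mu>) + (\<integral>x. indicator (D i) x *\<^sub>R b i \<partial>\<mu>)"
        using int1 int3 
        by (subst Bochner_Integration.integral_add)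
          (auto simp: integral_inner_right simp del: inner_scaleR_right real_scaleR_def)
      also have "(\<integral>x. indicator (D i) x *\<^sub>R x \<partial>\<mu>) = (\<integral>q. indicator (D i) (fst q) *\<^sub>R snd q \<partial>\<pi>)"
        using bary D by (simp add: barycenter_map_def)
      also have "(\<integral>x. indicator (D i) x *\<^sub>R b i \<partial>\<mu>) = (\<integral>q. indicator (D i) (fst q) *\<^sub>R b i \<partial>\<pi>)"
        by (rule couplings_integral(1)[OF \<pi>, symmetric]) measurable
      also have "g i \<bullet> (\<integral>q. indicator (D i) (fst q) *\<^sub>R snd q \<partial>\<pi>) + \<dots>
          = (\<integral>q. g i \<bullet> (indicator (D i) (fst q) *\<^sub>R snd q) + indicator (D i) (fst q) *\<^sub>R b i \<partial>\<pi>)"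
        using int2 int4 
        by (subst Bochner_Integration.integral_add)
          (auto simp: integral_inner_right simp del: inner_scaleR_right real_scaleR_def)
      also have "\<dots> = (\<integral>q. indicator (D i) (fst q) * (g i \<bullet> snd q + b i) \<partial>\<pi>)"
        by (simp add: algebra_simps)
      finally show ?thesis .
    qed
    have int5: "integrable \<mu> (\<lambda>x. indicator (D i) x * (g i \<bullet> x + b i))" for i
      using integrable_mult_indicator[OF _ int_\<mu>, of "D i" "\<lambda>x. g i \<bullet> x + b i"]
      by (simp add: continuous_intros)
    have int6: "integrable \<pi> (\<lambda>q. indicator (D i) (fst q) * (g i \<bullet> snd q + b i))" for i
      using ind_fst[OF D, of "\<lambda>x. g i \<bullet> x + b i"] by (simp add: continuous_intros)
    have "(\<integral>x. f x \<partial>\<mu>) \<le> (\<integral>x. (\<Sum>i<n. indicator (D i) x * (g i \<bullet> x + b i)) + e \<partial>\<mu>)"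
    proof (rule integral_mono_AE)
      show "AE x in \<mu>. f x \<le> (\<Sum>i<n. indicator (D i) x * (g i \<bullet> x + b i)) + e"
        using P2D(3)[OF \<mu>]
      proof eventually_elim
        fix x assume "x \<in> \<Omega>"
        have "f x - e = (\<Sum>i<n. indicator (D i) x * (f x - e))"
          using D_sum[OF \<open>x \<in> \<Omega>\<close>] by (simp add: sum_distrib_right[symmetric])
        also have "\<dots> \<le> (\<Sum>i<n. indicator (D i) x * (g i \<bullet> x + b i))"
          using D_sub by (intro sum_mono) (fastforce simp: indicator_def)
        finally show "f x \<le> (\<Sum>i<n. indicator (D i) x * (g i \<bullet> x + b i)) + e" by simp
      qed
    qed (rule int_\<mu>[OF f_cont] Bochner_Integration.integrable_add Bochner_Integration.integrable_sum int5
        \<mu>.integrable_const)+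
    also have "\<dots> = (\<Sum>i<n. \<integral>x. indicator (D i) x * (g i \<bullet> x + b i) \<partial>\<mu>) + e"
      by (subst Bochner_Integration.integral_add, rule Bochner_Integration.integrable_sum, rule int5, simp,
          subst Bochner_Integration.integral_sum, rule int5, simp add: \<mu>.prob_space)
    also have "\<dots> = (\<integral>q. (\<Sum>i<n. indicator (D i) (fst q) * (g i \<bullet> snd q + b i)) \<partial>\<pi>) + e"
      by (subst Bochner_Integration.integral_sum, rule int6, simp only: affine)
    also have "(\<integral>q. (\<Sum>i<n. indicator (D i) (fst q) * (g i \<bullet> snd q + b i)) \<partial>\<pi>) \<le> (\<integral>q. f (snd q) \<partial>\<pi>)"
    proof (rule integral_mono_AE)
      show "AE q in \<pi>. (\<Sum>i<n. indicator (D i) (fst q) * (g i \<bullet> snd q + b i)) \<le> f (snd q)"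
        using couplings_AE(1)[OF \<pi> P2D(3)[OF \<mu>]]
      proof eventually_elim
        fix q :: "'a \<times> 'a" assume "fst q \<in> \<Omega>"
        \<comment> \<open>The piece is selected by the first coordinate while \<open>f\<close> is
          evaluated at the second, so only minorization is used here, not closeness.\<close>
        have "(\<Sum>i<n. indicator (D i) (fst q) * (g i \<bullet> snd q + b i)) \<le> (\<Sum>i<n. indicator (D i) (fst q) * f (snd q))"
          using below by (intro sum_mono mult_left_mono) auto
        also have "\<dots> = f (snd q)"
          using D_sum[OF \<open>fst q \<in> \<Omega>\<close>] by (simp add: sum_distrib_right[symmetric])
        finally show "(\<Sum>i<n. indicator (D i) (fst q) * (g i \<bullet> snd q + b i)) \<le> f (snd q)" .
      qed
    qed (rule int_snd[OF f_cont] Bochner_Integration.integrable_sum int6)+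
    also have "(\<integral>q. f (snd q) \<partial>\<pi>) = (\<integral>x. f x \<partial>\<nu>)"
      by (rule couplings_integral(2)[OF \<pi>]) measurable
    finally show "(\<integral>x. f x \<partial>\<mu>) \<le> (\<integral>x. f x \<partial>\<nu>) + e" by simp
  qed
qed

section \<open>Weak optimizers\<close>

text \<open>Extends the defining identity of a barycenter map from indicators to general weights:
  first to simple functions through their level sets, then by dominated convergence.\<close>

lemma integral_mult_eqI_indicator:
  fixes \<phi> c :: "'a::euclidean_space \<Rightarrow> real" and Y :: "'b \<Rightarrow> real"
  assumes M: "sets M = sets borel" and T[measurable]: "T \<in> borel_measurable N"
    and c: "integrable M c" and Y: "integrable N Y"
    and eq: "\<And>A. A \<in> sets borel \<Longrightarrow> (\<integral>x. indicator A x * c x \<partial>M) = (\<integral>q. indicator A (T q) * Y q \<partial>N)"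
    and [measurable]: "\<phi> \<in> borel_measurable borel"
    and \<phi>c: "integrable M (\<lambda>x. \<phi> x * c x)" and \<phi>Y: "integrable N (\<lambda>q. \<phi> (T q) * Y q)"
  shows "(\<integral>x. \<phi> x * c x \<partial>M) = (\<integral>q. \<phi> (T q) * Y q \<partial>N)"
proof -
  note [measurable_cong] = M
  have [measurable]: "c \<in> borel_measurable M" "Y \<in> borel_measurable N" using c Y by auto
  \<comment> \<open>Approximation relative to the base point 0; its factor 2 is the one in the
    dominating functions below.\<close>
  obtain F where F: "\<And>i. simple_function borel (F i)" "\<And>x. (\<lambda>i. F i x) \<longlonglongrightarrow> \<phi> x"
    "\<And>i x. \<bar>F i x\<bar> \<le> 2 * \<bar>\<phi> x\<bar>"
    using borel_measurable_implies_sequence_metric[of \<phi> borel 0] by auto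
  have [measurable]: "F i \<in> borel_measurable borel" for i
    using F(1) by (rule borel_measurable_simple_function)
  have simple: "(\<integral>x. F i x * c x \<partial>M) = (\<integral>q. F i (T q) * Y q \<partial>N)" for i
  proof -
    define V where "V = range (F i)"
    have fin: "finite V" using simple_functionD(1)[OF F(1)[of i]] by (simp add: V_def)
    have lev[measurable]: "F i -` {v} \<in> sets borel" for v
      using measurable_sets[of "F i" borel borel "{v}"] by simp
    have rep: "F i x * r = (\<Sum>v\<in>V. v * (indicator (F i -` {v}) x * r))" for x r
    proof -
      have "(\<Sum>v\<in>V. v * (indicator (F i -` {v}) x * r)) = (\<Sum>v\<in>V. if F i x = v then v * r else 0)"
        by (intro sum.cong) (auto simp: indicator_def)
      then show ?thesis using fin by (simp add: V_def)
    qed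
    have int1: "integrable M (\<lambda>x. indicator (F i -` {v}) x * c x)" for v
      using integrable_mult_indicator[OF _ c, of "F i -` {v}"] M by simp
    have int2: "integrable N (\<lambda>q. indicator (F i -` {v}) (T q) * Y q)" for v
      by (rule Bochner_Integration.integrable_bound[OF Y]) (auto simp: indicator_def)
    have "(\<integral>x. F i x * c x \<partial>M) = (\<Sum>v\<in>V. v * (\<integral>x. indicator (F i -` {v}) x * c x \<partial>M))"
      unfolding rep using int1 by (subst Bochner_Integration.integral_sum) auto
    also have "\<dots> = (\<Sum>v\<in>V. v * (\<integral>q. indicator (F i -` {v}) (T q) * Y q \<partial>N))"
      by (simp add: eq[OF lev])
    also have "\<dots> = (\<integral>q. F i (T q) * Y q \<partial>N)"
      unfolding rep using int2 by (subst Bochner_Integration.integral_sum) auto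
    finally show ?thesis .
  qed
  have "(\<lambda>i. \<integral>x. F i x * c x \<partial>M) \<longlonglongrightarrow> (\<integral>x. \<phi> x * c x \<partial>M)"
  proof (rule integral_dominated_convergence[where w="\<lambda>x. 2 * \<bar>\<phi> x * c x\<bar>"])
    show "AE x in M. norm (F i x * c x) \<le> 2 * \<bar>\<phi> x * c x\<bar>" for i
      using F(3) by (auto simp: abs_mult mult_right_mono mult.assoc[symmetric])
  qed (use \<phi>c F(2) in \<open>auto intro!: tendsto_mult_right\<close>)
  moreover have "(\<lambda>i. \<integral>q. F i (T q) * Y q \<partial>N) \<longlonglongrightarrow> (\<integral>q. \<phi> (T q) * Y q \<partial>N)"
  proof (rule integral_dominated_convergence[where w="\<lambda>q. 2 * \<bar>\<phi> (T q) * Y q\<bar>"])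
    show "AE q in N. norm (F i (T q) * Y q) \<le> 2 * \<bar>\<phi> (T q) * Y q\<bar>" for i
      using F(3) by (auto simp: abs_mult mult_right_mono mult.assoc[symmetric])
  qed (use \<phi>Y F(2) in \<open>auto intro!: tendsto_mult_right\<close>)
  ultimately show ?thesis unfolding simple by (rule LIMSEQ_unique)
qed

lemma integrable_P2_ident:
  fixes M :: "'a::euclidean_space measure"
  assumes "M \<in> P2 \<Omega>" "compact \<Omega>"
  shows "integrable M (\<lambda>x. x)"
  by (rule integrable_continuous_AE_compact[OF P2D(1,2)[OF assms(1)] assms(2) P2D(3)[OF assms(1)]])
     (rule continuous_on_id)

text \<open>Tower property, obtained coordinate by coordinate; \<open>\<phi>\<close> is bounded
  almost everywhere, so the products are integrable. It is applied to the identity and to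
  \<open>c\<close> itself.\<close>

lemma barycenter_integral_inner:
  fixes \<phi> c :: "'a::euclidean_space \<Rightarrow> 'a"
  assumes "compact \<Omega>" and \<mu>: "\<mu> \<in> P2 \<Omega>" and \<nu>: "\<nu> \<in> P2 \<Omega>" and \<pi>: "\<pi> \<in> couplings \<mu> \<nu>"
    and bary: "barycenter_map \<pi> \<mu> c"
    and \<phi>[measurable]: "\<phi> \<in> borel_measurable borel" and \<phi>_in: "AE x in \<mu>. \<phi> x \<in> \<Omega>"
  shows "integrable \<mu> (\<lambda>x. \<phi> x \<bullet> c x)" "integrable \<pi> (\<lambda>q. \<phi> (fst q) \<bullet> snd q)"
    "(\<integral>x. \<phi> x \<bullet> c x \<partial>\<mu>) = (\<integral>q. \<phi> (fst q) \<bullet> snd q \<partial>\<pi>)"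
proof -
  note [measurable] = couplings_measurable[OF \<pi>]
  note [measurable_cong] = P2D(2)[OF \<mu>]
  have c: "integrable \<mu> c" and [measurable]: "c \<in> borel_measurable borel"
    using bary by (auto simp: barycenter_map_def)
  have Y: "integrable \<pi> snd"
    using couplings_integral(4)[OF \<pi> measurable_ident, THEN iffD2] integrable_P2_ident[OF \<nu> assms(1)]
    by (simp add: id_def)
  obtain R where R: "\<And>x. x \<in> \<Omega> \<Longrightarrow> norm x \<le> R"
    using compact_imp_bounded[OF assms(1)] by (auto simp: bounded_iff)
  have bnd: "AE x in \<mu>. \<forall>b\<in>Basis. \<bar>\<phi> x \<bullet> b\<bar> \<le> R"
    using \<phi>_in
  proof eventually_elim
    fix x assume "\<phi> x \<in> \<Omega>"
    then show "\<forall>b\<in>Basis. \<bar>\<phi> x \<bullet> b\<bar> \<le> R" using R Basis_le_norm[of _ "\<phi> x"] by force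
  qed
  have bnd': "AE q in \<pi>. \<forall>b\<in>Basis. \<bar>\<phi> (fst q) \<bullet> b\<bar> \<le> R"
    by (rule couplings_AE(1)[OF \<pi> bnd])
  have prod_le: "norm (s * t) \<le> norm (R * t)" if "\<bar>s\<bar> \<le> R" for s t
    using that by (simp add: abs_mult mult_right_mono)
  have int1: "integrable \<mu> (\<lambda>x. (\<phi> x \<bullet> b) * (c x \<bullet> b))" if "b \<in> Basis" for b
  proof (rule Bochner_Integration.integrable_bound)
    show "integrable \<mu> (\<lambda>x. R * (c x \<bullet> b))" using c by simp
    show "AE x in \<mu>. norm ((\<phi> x \<bullet> b) * (c x \<bullet> b)) \<le> norm (R * (c x \<bullet> b))"
      using bnd by eventually_elim
        (rule prod_le, use that in blast)
  qed simp
  have int2: "integrable \<pi> (\<lambda>q. (\<phi> (fst q) \<bullet> b) * (snd q \<bullet> b))" if "b \<in> Basis" for b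
  proof (rule Bochner_Integration.integrable_bound)
    show "integrable \<pi> (\<lambda>q. R * (snd q \<bullet> b))"
      by (intro integrable_mult_right integrable_inner_left Y)
    show "AE q in \<pi>. norm ((\<phi> (fst q) \<bullet> b) * (snd q \<bullet> b)) \<le> norm (R * (snd q \<bullet> b))"
      using bnd' by eventually_elim
        (rule prod_le, use that in blast)
  qed simp
  have coord: "(\<integral>x. (\<phi> x \<bullet> b) * (c x \<bullet> b) \<partial>\<mu>) = (\<integral>q. (\<phi> (fst q) \<bullet> b) * (snd q \<bullet> b) \<partial>\<pi>)"
    if "b \<in> Basis" for b
  proof (rule integral_mult_eqI_indicator[where \<phi>="\<lambda>x. \<phi> x \<bullet> b" and T=fst])
    fix A :: "'a set" assume A[measurable]: "A \<in> sets borel"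
    have i1: "integrable \<mu> (\<lambda>x. indicator A x *\<^sub>R c x)"
      using c by (rule integrable_mult_indicator[rotated]) (simp add: P2D(2)[OF \<mu>])
    have i2: "integrable \<pi> (\<lambda>q. indicator A (fst q) *\<^sub>R snd q)"
      by (rule Bochner_Integration.integrable_bound[OF Y]) (auto simp: indicator_def)
    have "(\<integral>x. indicator A x * (c x \<bullet> b) \<partial>\<mu>) = (\<integral>x. indicator A x *\<^sub>R c x \<partial>\<mu>) \<bullet> b"
      by (subst integral_inner_left[symmetric]) (use i1 in auto)
    also have "\<dots> = (\<integral>q. indicator A (fst q) *\<^sub>R snd q \<partial>\<pi>) \<bullet> b"
      using bary A by (simp add: barycenter_map_def)
    also have "\<dots> = (\<integral>q. indicator A (fst q) * (snd q \<bullet> b) \<partial>\<pi>)"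
      by (subst integral_inner_left[symmetric]) (use i2 in auto)
    finally show "(\<integral>x. indicator A x * (c x \<bullet> b) \<partial>\<mu>) = (\<integral>q. indicator A (fst q) * (snd q \<bullet> b) \<partial>\<pi>)" .
  qed (use c Y int1 int2 that P2D(2)[OF \<mu>] in auto)
  have e: "(\<lambda>x. \<phi> x \<bullet> c x) = (\<lambda>x. \<Sum>b\<in>Basis. (\<phi> x \<bullet> b) * (c x \<bullet> b))"
    "(\<lambda>q. \<phi> (fst q) \<bullet> snd q) = (\<lambda>q. \<Sum>b\<in>Basis. (\<phi> (fst q) \<bullet> b) * (snd q \<bullet> b))"
    by (intro ext euclidean_inner)+
  show "integrable \<mu> (\<lambda>x. \<phi> x \<bullet> c x)" "integrable \<pi> (\<lambda>q. \<phi> (fst q) \<bullet> snd q)"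
    unfolding e by (auto intro!: Bochner_Integration.integrable_sum int1 int2)
  show "(\<integral>x. \<phi> x \<bullet> c x \<partial>\<mu>) = (\<integral>q. \<phi> (fst q) \<bullet> snd q \<partial>\<pi>)"
    unfolding e using int1 int2 coord by simp
qed

text \<open>The tower property with \<open>\<phi> = c\<close> equates the integrals of
  \<open>c x \<bullet> y\<close> and \<open>c x \<bullet> c x\<close>, which is the Kantorovich
  condition for the image of \<pi> under \<open>(x, y) \<mapsto> (c x, y)\<close>.\<close>

lemma K_dom_barycenter:
  fixes c :: "'a::euclidean_space \<Rightarrow> 'a"
  assumes "compact \<Omega>" and \<mu>: "\<mu> \<in> P2 \<Omega>" and \<nu>: "\<nu> \<in> P2 \<Omega>" and \<pi>: "\<pi> \<in> couplings \<mu> \<nu>"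
    and bary: "barycenter_map \<pi> \<mu> c" and c_in: "AE x in \<mu>. c x \<in> \<Omega>" and "mean \<nu> = 0"
  shows "K_dom (distr \<mu> borel c) \<nu>"
  unfolding K_dom_def
proof
  have [measurable]: "c \<in> borel_measurable borel" using bary by (simp add: barycenter_map_def)
  note [measurable] = couplings_measurable[OF \<pi>]
  interpret \<pi>: prob_space \<pi> using \<pi> by (simp add: couplings_def)
  define \<pi>' where "\<pi>' = distr \<pi> borel (\<lambda>q. (c (fst q), snd q))"
  have [measurable]: "(\<lambda>q. (c (fst q), snd q)) \<in> borel_measurable \<pi>"
    by (rule borel_measurable_Pair) measurable
  have [measurable]: "(fst :: 'a \<times> 'a \<Rightarrow> 'a) \<in> borel_measurable borel"
    "(snd :: 'a \<times> 'a \<Rightarrow> 'a) \<in> borel_measurable borel"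
    by (auto intro!: borel_measurable_continuous_onI continuous_intros)
  have "distr \<pi>' borel fst = distr (distr \<pi> borel fst) borel c"
    by (simp add: \<pi>'_def distr_distr comp_def)
  moreover have "distr \<pi>' borel snd = distr \<pi> borel snd"
    by (simp add: \<pi>'_def distr_distr comp_def)
  ultimately show "\<pi>' \<in> couplings (distr \<mu> borel c) \<nu>"
    using \<pi> by (auto simp: couplings_def \<pi>'_def intro!: \<pi>.prob_space_distr)
  note B = barycenter_integral_inner[OF assms(1) \<mu> \<nu> \<pi> bary _ c_in]
  have int: "integrable \<pi> (\<lambda>q. c (fst q) \<bullet> c (fst q))"
    using couplings_integral(3)[OF \<pi>, of "\<lambda>x. c x \<bullet> c x"] B(1) by simp
  have "(\<integral>p. (fst p - mean \<nu>) \<bullet> (snd p - fst p) \<partial>\<pi>')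
      = (\<integral>q. c (fst q) \<bullet> snd q - c (fst q) \<bullet> c (fst q) \<partial>\<pi>)"
    by (simp add: \<pi>'_def integral_distr \<open>mean \<nu> = 0\<close> inner_diff_right)
  also have "\<dots> = (\<integral>x. c x \<bullet> c x \<partial>\<mu>) - (\<integral>q. c (fst q) \<bullet> c (fst q) \<partial>\<pi>)"
    using int B(2,3) by simp
  also have "\<dots> = 0"
    using couplings_integral(1)[OF \<pi>, of "\<lambda>x. c x \<bullet> c x"] by simp
  finally show "(\<integral>p. (fst p - mean \<nu>) \<bullet> (snd p - fst p) \<partial>\<pi>') = 0" .
qed

lemma Var_eq_second_moment_diff:
  assumes "M \<in> P2 \<Omega>" "compact \<Omega>"
  shows "Var M = (\<integral>x. (norm x)\<^sup>2 \<partial>M) - (norm (mean M))\<^sup>2"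
proof -
  interpret prob_space M using P2D[OF assms(1)] by simp
  have id: "integrable M (\<lambda>x. x)" using integrable_P2_ident[OF assms] .
  have "Var M = (\<integral>x. (norm x)\<^sup>2 - 2 * (x \<bullet> mean M) + (norm (mean M))\<^sup>2 \<partial>M)"
    by (simp add: Var_def power2_norm_eq_inner inner_diff_left inner_diff_right inner_commute algebra_simps)
  also have "\<dots> = (\<integral>x. (norm x)\<^sup>2 \<partial>M) - 2 * (mean M \<bullet> mean M) + (norm (mean M))\<^sup>2"
    using id P2D(4)[OF assms(1)] by (simp add: prob_space mean_def)
  finally show ?thesis by (simp add: power2_norm_eq_inner)
qed

theorem mainTheorem15:
  fixes \<Omega> :: "'a::euclidean_space set" and \<nu> \<mu> :: "'a measure" and D :: "'a measure set"
  assumes "compact \<Omega>" and "convex \<Omega>" and "0 \<in> \<Omega>"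
    and "\<nu> \<in> P20 \<Omega>"
    and "D \<subseteq> P2 \<Omega>"
    and "closed_weak_opt D \<nu> \<Omega>"
    and "maximizes_Var (D \<inter> MK \<nu> \<Omega>) \<mu>"
  shows "convex_order \<mu> \<nu> \<and> maximizes_Var {\<mu>' \<in> D. convex_order \<mu>' \<nu>} \<mu>"
proof
  have \<nu>: "\<nu> \<in> P2 \<Omega>" "mean \<nu> = 0" using assms(4) by (auto simp: P20_def)
  have \<mu>_in: "\<mu> \<in> D" and \<mu>: "\<mu> \<in> P2 \<Omega>" using assms(5,7) by (auto simp: maximizes_Var_def)
  have maxi: "Var \<mu>' \<le> Var \<mu>" if "\<mu>' \<in> D" "K_dom \<mu>' \<nu>" for \<mu>'
    using assms(5,7) that by (auto simp: maximizes_Var_def MK_def)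
  obtain \<pi> c where \<pi>: "\<pi> \<in> couplings \<mu> \<nu>"
    and opt: "(\<integral>p. fst p \<bullet> snd p \<partial>\<pi>) \<ge> (\<integral>x. (norm x)\<^sup>2 \<partial>\<mu>)"
    and bary: "barycenter_map \<pi> \<mu> c" and \<eta>_in: "distr \<mu> borel c \<in> D"
    using assms(6,7) unfolding closed_weak_opt_def by blast
  define \<eta> where "\<eta> = distr \<mu> borel c"
  have \<eta>: "\<eta> \<in> P2 \<Omega>" using \<eta>_in assms(5) by (auto simp: \<eta>_def)
  interpret \<mu>: prob_space \<mu> using P2D[OF \<mu>] by simp
  note [measurable_cong] = P2D(2)[OF \<mu>]
  have [measurable]: "c \<in> borel_measurable borel" and c: "integrable \<mu> c"
    using bary by (auto simp: barycenter_map_def)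
  \<comment> \<open>Membership in \<open>D\<close> places the image measure on
    \<open>\<Omega>\<close>, so \<open>c\<close> is bounded almost everywhere.\<close>
  have c_in: "AE x in \<mu>. c x \<in> \<Omega>"
    using P2D(3)[OF \<eta>] unfolding \<eta>_def by (rule AE_distrD[rotated]) measurable
  have id_in: "AE x in \<mu>. x \<in> \<Omega>" by (rule P2D(3)[OF \<mu>])
  note Bc = barycenter_integral_inner[OF assms(1) \<mu> \<nu>(1) \<pi> bary _ c_in]
  note Bx = barycenter_integral_inner[OF assms(1) \<mu> \<nu>(1) \<pi> bary _ id_in]
  have "mean \<eta> = (\<integral>x. c x \<partial>\<mu>)" by (simp add: mean_def \<eta>_def integral_distr)
  also have "\<dots> = (\<integral>q. snd q \<partial>\<pi>)"
    using bary by (auto simp: barycenter_map_def dest!: bspec[where x=UNIV])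
  also have "\<dots> = 0"
    using couplings_integral(2)[OF \<pi>, of "\<lambda>x. x"] \<nu>(2) by (simp add: mean_def)
  finally have "Var \<eta> = (\<integral>x. (norm x)\<^sup>2 \<partial>\<eta>)"
    using Var_eq_second_moment_diff[OF \<eta> assms(1)] by simp
  then have Var_\<eta>: "Var \<eta> = (\<integral>x. c x \<bullet> c x \<partial>\<mu>)"
    by (simp add: \<eta>_def integral_distr power2_norm_eq_inner)
  have "Var \<eta> \<le> Var \<mu>"
    unfolding \<eta>_def by (rule maxi[OF \<eta>_in K_dom_barycenter[OF assms(1) \<mu> \<nu>(1) \<pi> bary c_in \<nu>(2)]])
  \<comment> \<open>The squared norm of the mean of \<mu> is discarded; an inequality
    suffices.\<close>
  also have "Var \<mu> \<le> (\<integral>x. (norm x)\<^sup>2 \<partial>\<mu>)"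
    using Var_eq_second_moment_diff[OF \<mu> assms(1)] by simp
  finally have le: "(\<integral>x. c x \<bullet> c x \<partial>\<mu>) \<le> (\<integral>x. (norm x)\<^sup>2 \<partial>\<mu>)" by (simp add: Var_\<eta>)
  have sq: "(norm (x - c x))\<^sup>2 = (norm x)\<^sup>2 - 2 * (x \<bullet> c x) + c x \<bullet> c x" for x
    by (simp add: power2_norm_eq_inner inner_diff_left inner_diff_right inner_commute)
  have int_sq: "integrable \<mu> (\<lambda>x. (norm (x - c x))\<^sup>2)"
    unfolding sq using P2D(4)[OF \<mu>] Bx(1) Bc(1) by simp
  have "(\<integral>x. (norm (x - c x))\<^sup>2 \<partial>\<mu>) = (\<integral>x. (norm x)\<^sup>2 \<partial>\<mu>) - 2 * (\<integral>x. x \<bullet> c x \<partial>\<mu>) + (\<integral>x. c x \<bullet> c x \<partial>\<mu>)"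
    unfolding sq using P2D(4)[OF \<mu>] Bx(1) Bc(1) by simp
  \<comment> \<open>The integral of \<open>x \<bullet> c x\<close> equals that of
    \<open>fst q \<bullet> snd q\<close>, which is at least the second moment of \<mu>, and that in
    turn bounds the integral of \<open>c x \<bullet> c x\<close>.\<close>
  also have "\<dots> \<le> 0" using le opt Bx(3) by simp
  finally have "(\<integral>x. (norm (x - c x))\<^sup>2 \<partial>\<mu>) = 0"
    by (intro antisym) (auto intro!: integral_nonneg_AE)
  then have "AE x in \<mu>. (norm (x - c x))\<^sup>2 = 0"
    using integral_nonneg_eq_0_iff_AE[OF int_sq] by simp
  then have ae: "AE x in \<mu>. c x = x" by eventually_elim simp
  \<comment> \<open>Barycenter maps matter only up to null sets, so the identity may replace
    \<open>c\<close>: \<pi> is a martingale coupling.\<close>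
  have "barycenter_map \<pi> \<mu> (\<lambda>x. x)"
    unfolding barycenter_map_def
  proof (intro conjI ballI)
    show "integrable \<mu> (\<lambda>x. x)" by (rule integrable_P2_ident[OF \<mu> assms(1)])
    fix A :: "'a set" assume [measurable]: "A \<in> sets borel"
    have "(\<integral>x. indicator A x *\<^sub>R x \<partial>\<mu>) = (\<integral>x. indicator A x *\<^sub>R c x \<partial>\<mu>)"
      by (rule integral_cong_AE) (use ae in auto)
    then show "(\<integral>x. indicator A x *\<^sub>R x \<partial>\<mu>) = (\<integral>p. indicator A (fst p) *\<^sub>R snd p \<partial>\<pi>)"
      using bary by (simp add: barycenter_map_def)
  qed simp
  then show co: "convex_order \<mu> \<nu>"
    by (rule martingale_coupling_imp_convex_order[OF assms(1) \<mu> \<nu>(1) \<pi>])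
  \<comment> \<open>On \<open>\<Omega>\<close> convex order implies Kantorovich dominance, so each
    competitor of the second claim was already one for the given maximizer.\<close>
  have "Var \<mu>' \<le> Var \<mu>" if \<mu>'_in: "\<mu>' \<in> D" and co': "convex_order \<mu>' \<nu>" for \<mu>'
  proof (rule maxi[OF \<mu>'_in])
    have \<mu>': "\<mu>' \<in> P2 \<Omega>" using \<mu>'_in assms(5) by blast
    obtain \<rho> where \<rho>: "\<rho> \<in> couplings \<mu>' \<nu>" "(\<integral>q. fst q \<bullet> snd q \<partial>\<rho>) = (\<integral>x. (norm x)\<^sup>2 \<partial>\<mu>')"
      using convex_order_imp_coupling[OF assms(1) \<mu>' \<nu>(1) co'] by metis
    note [measurable] = couplings_measurable[OF \<rho>(1)]
    have sq': "integrable \<rho> (\<lambda>q. (norm (fst q))\<^sup>2)" "(\<integral>q. (norm (fst q))\<^sup>2 \<partial>\<rho>) = (\<integral>x. (norm x)\<^sup>2 \<partial>\<mu>')"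
      using couplings_integral(1,3)[OF \<rho>(1), of "\<lambda>x. (norm x)\<^sup>2"] P2D(4)[OF \<mu>'] by simp_all
    have "integrable \<rho> (\<lambda>q. (norm (snd q))\<^sup>2)"
      using couplings_integral(4)[OF \<rho>(1), of "\<lambda>x. (norm x)\<^sup>2"] P2D(4)[OF \<nu>(1)] by simp
    with sq'(1) have "integrable \<rho> (\<lambda>q. (norm (fst q))\<^sup>2 + (norm (snd q))\<^sup>2)" by simp
    \<comment> \<open>Integrability of the cost allows the integral of the difference to be
      split.\<close>
    then have "integrable \<rho> (\<lambda>q. fst q \<bullet> snd q)"
    proof (rule Bochner_Integration.integrable_bound)
      show "AE q in \<rho>. norm (fst q \<bullet> snd q) \<le> norm ((norm (fst q))\<^sup>2 + (norm (snd q))\<^sup>2)"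
      proof (rule AE_I2)
        fix q :: "'a \<times> 'a"
        have "\<bar>fst q \<bullet> snd q\<bar> \<le> norm (fst q) * norm (snd q)" by (rule Cauchy_Schwarz_ineq2)
        also have "\<dots> \<le> (norm (fst q))\<^sup>2 + (norm (snd q))\<^sup>2"
          using sum_squares_bound[of "norm (fst q)" "norm (snd q)"]
            mult_nonneg_nonneg[OF norm_ge_zero[of "fst q"] norm_ge_zero[of "snd q"]] by linarith
        finally show "norm (fst q \<bullet> snd q) \<le> norm ((norm (fst q))\<^sup>2 + (norm (snd q))\<^sup>2)" by simp
      qed
    qed simp
    then have "(\<integral>p. fst p \<bullet> snd p - (norm (fst p))\<^sup>2 \<partial>\<rho>) = 0"
      using sq' \<rho>(2) by simp
    then show "K_dom \<mu>' \<nu>"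
      unfolding K_dom_def using \<rho>(1) \<nu>(2)
      by (intro bexI[of _ \<rho>]) (simp_all add: inner_diff_right power2_norm_eq_inner)
  qed
  then show "maximizes_Var {\<mu>' \<in> D. convex_order \<mu>' \<nu>} \<mu>"
    using \<mu>_in co by (auto simp: maximizes_Var_def)
qed

end
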